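(* Let $(X,\mathbf h,\Lambda_0,\widetilde B_0)$ be a coprime quantum seed and $i\in[1,n]$, with $(X',\mathbf h,\Lambda_1,\widetilde B_1)=\mu_i(X,\mathbf h,\Lambda_0,\widetilde B_0)$. Then $$\mathcal U(X,\mathbf h,\Lambda_0,\widetilde B_0)=\mathcal U(X',\mathbf h,\Lambda_1,\widetilde B_1).$$ Moreover, if every quantum seed mutation-equivalent to $(X,\mathbf h,\Lambda_0,\widetilde B_0)$ is coprime, then for every seed $\Sigma$ mutation-equivalent to $(X,\mathbf h,\Lambda_0,\widetilde B_0)$ the upper bound $\mathcal U(\Sigma)$ equals the generalized quantum upper cluster algebra $\widetilde{\mathcal U}(X,\mathbf h,\Lambda_0,\widetilde B_0)$.
   Context: Notation: $[a,b]=\{a,a+1,\dots,b\}$; $[x]_+=\max(x,0)$, applied entrywise to vectors; $e_1,\dots,e_m$ is the standard basis of $\mathbb Z^m$. Fix integers $m\ge n\ge 1$. A compatible pair $(\Lambda,\widetilde B)$ consists of an $m\times n$ integer matrix $\widetilde B=(b_{kl})$ and a skew-symmetric $m\times m$ integer matrix $\Lambda$ such that $\Lambda\widetilde B=-\begin{bmatrix}D\\0\end{bmatrix}$ for some $D=\mathrm{diag}(\tilde d_1,\dots,\tilde d_n)$ with all $\tilde d_k\in\mathbb Z_{>0}$. Write $\Lambda(a,b)=a^T\Lambda b$. Fix positive integers $d_1,\dots,d_n$ such that $d_k$ divides every entry of the $k$-th column $b^k$ of $\widetilde B$ (preserved under mutation); $\beta^k=\frac1{d_k}b^k$. The quantum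 torus $\mathcal T(\Lambda)$ is the $\mathbb Z[q^{\pm1/2}]$-algebra with basis $\{X(c)\mid c\in\mathbb Z^m\}$ and multiplication $X(c)X(d)=q^{\frac12\Lambda(c,d)}X(c+d)$; $\mathcal F$ is its skew field of fractions, $X_k=X(e_k)$. For $k\in[1,n]$, $\mathbf h_k=(h_{k,0},\dots,h_{k,d_k})$ with $h_{k,r}\in\mathbb Z[q^{\pm1/2}]$, $h_{k,r}=h_{k,d_k-r}$, $h_{k,0}=h_{k,d_k}=1$. A quantum seed $(X,\mathbf h,\Lambda,\widetilde B)$ consists of a compatible pair, $\mathbf h$, and a map $X:\mathbb Z^m\to\mathcal F$ with $X(c)X(d)=q^{\frac12\Lambda(c,d)}X(c+d)$. Mutation in direction $i$: $\mu_i(X,\mathbf h,\Lambda,\widetilde B)=(X',\mathbf h,E^T\Lambda E,E\widetilde BF)$ where $E_{kl}=\delta_{kl}$ ($l\neq i$), $E_{ii}=-1$, $E_{ki}=[-\varepsilon b_{ki}]_+$ ($k\ne i$), $F_{kl}=\delta_{kl}$ ($k\ne i$), $F_{ii}=-1$, $F_{il}=[\varepsilon b_{il}]_+$ ($l\ne i$), $\varepsilon\in\{\pm1\}$ arbitrary, and $X'$ is the map satisfying $X'(c)X'(d)=q^{\frac12\Lambda'(c,d)}X'(c+d)$ for $\Lambda'=E^T\Lambda E$, determined by $X'(e_k)=X(e_k)$ ($k\ne i$) and $X'(e_i)=\sum_{r=0}^{d_i}h_{i,r}X(r[\beta^i]_++(d_i-r)[-\beta^i]_+-e_i)$; write $X'_k=X'(e_k)$.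 Seeds related by finite sequences of mutations are mutation-equivalent ($\sim$); $X_{n+1},\dots,X_m$ are unchanged by mutation. $\mathbb{ZP}$ is the ring of Laurent polynomials in $X_{n+1},\dots,X_m$ with coefficients in $\mathbb Z[q^{\pm1/2}]$; for $Y_1,\dots,Y_s\in\mathcal F$, $\mathbb{ZP}[Y_1,\dots,Y_s]$ is the subring of $\mathcal F$ generated by $\mathbb{ZP}$ and the $Y_k$ (exponent $\pm1$ means both $Y$ and $Y^{-1}$ are adjoined). For a seed $\Sigma=(X,\mathbf h,\Lambda,\widetilde B)$ let $\mathbb L(\Sigma)=\mathbb{ZP}[X_1^{\pm1},\dots,X_n^{\pm1}]$; the upper bound is $\mathcal U(\Sigma)=\mathbb L(\Sigma)\cap\bigcap_{i=1}^n\mathbb L(\mu_i(\Sigma))$. The generalized quantum upper cluster algebra is $\widetilde{\mathcal U}(\Sigma)=\bigcap_{\Sigma'\sim\Sigma}\mathbb L(\Sigma')$. For $i\neq j$, $X_iX'_i$ and $X_jX'_j$ (with $X'_k$ the $k$-th cluster variable of $\mu_k(\Sigma)$) are coprime if there is no non-invertible element $c$ of the center of $\mathbb{ZP}[X_1,\dots,X_n]$ dividing both; $\Sigma$ is coprime if this holds for all $i\ne j\in[1,n]$. *)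

theory Defs
  imports Main
begin

text \<open>Conventions. Indices are 1-based natural numbers. Integer vectors in Z^m are
functions nat => int vanishing outside [1,m]; integer matrices are functions
nat => nat => int (only entries with indices in range matter). The skew field F is
an arbitrary division ring type 'f; the element v plays the role of q^(1/2).
A quantum seed is a tuple (X, h, Lambda, B) with X : Z^m -> F, h k r = h_{k,r}.\<close>

type_synonym 'f seed =
  "((nat \<Rightarrow> int) \<Rightarrow> 'f) \<times> (nat \<Rightarrow> nat \<Rightarrow> 'f) \<times> (nat \<Rightarrow> nat \<Rightarrow> int) \<times> (nat \<Rightarrow> nat \<Rightarrow> int)"

definition zvec :: "nat \<Rightarrow> (nat \<Rightarrow> int) \<Rightarrow> bool" where
  "zvec m c \<longleftrightarrow> (\<forall>k. k \<notin> {1..m} \<longrightarrow> c k = 0)"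

definition unitv :: "nat \<Rightarrow> nat \<Rightarrow> int" where
  "unitv k = (\<lambda>j. if j = k then 1 else 0)"

definition bilin :: "nat \<Rightarrow> (nat \<Rightarrow> nat \<Rightarrow> int) \<Rightarrow> (nat \<Rightarrow> int) \<Rightarrow> (nat \<Rightarrow> int) \<Rightarrow> int" where
  "bilin m L c e = (\<Sum>k\<in>{1..m}. \<Sum>l\<in>{1..m}. c k * L k l * e l)"

definition compatible :: "nat \<Rightarrow> nat \<Rightarrow> (nat \<Rightarrow> nat \<Rightarrow> int) \<Rightarrow> (nat \<Rightarrow> nat \<Rightarrow> int) \<Rightarrow> bool" where
  "compatible m n L B \<longleftrightarrow>
     (\<forall>k\<in>{1..m}. \<forall>l\<in>{1..m}. L k l = - L l k) \<and>
     (\<exists>D :: nat \<Rightarrow> int. (\<forall>k\<in>{1..n}. D k > 0) \<and>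
        (\<forall>k\<in>{1..m}. \<forall>l\<in>{1..n}. (\<Sum>j\<in>{1..m}. L k j * B j l) = (if k = l then - D k else 0)))"

inductive_set subring_gen :: "'a::ring_1 set \<Rightarrow> 'a set" for S :: "'a set" where
  gen: "x \<in> S \<Longrightarrow> x \<in> subring_gen S"
| zero: "0 \<in> subring_gen S"
| one: "1 \<in> subring_gen S"
| add: "x \<in> subring_gen S \<Longrightarrow> y \<in> subring_gen S \<Longrightarrow> x + y \<in> subring_gen S"
| neg: "x \<in> subring_gen S \<Longrightarrow> - x \<in> subring_gen S"
| mult: "x \<in> subring_gen S \<Longrightarrow> y \<in> subring_gen S \<Longrightarrow> x * y \<in> subring_gen S"

definition Zq :: "'f::division_ring \<Rightarrow> 'f set" where
  "Zq v = subring_gen {v, inverse v}"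

definition qrule :: "nat \<Rightarrow> 'f::division_ring \<Rightarrow> (nat \<Rightarrow> nat \<Rightarrow> int) \<Rightarrow> ((nat \<Rightarrow> int) \<Rightarrow> 'f) \<Rightarrow> bool" where
  "qrule m v L X \<longleftrightarrow> (\<forall>c e. zvec m c \<longrightarrow> zvec m e \<longrightarrow> X c * X e = v powi (bilin m L c e) * X (\<lambda>k. c k + e k))"

definition h_ok :: "nat \<Rightarrow> (nat \<Rightarrow> nat) \<Rightarrow> 'f::division_ring \<Rightarrow> (nat \<Rightarrow> nat \<Rightarrow> 'f) \<Rightarrow> bool" where
  "h_ok n d v h \<longleftrightarrow> (\<forall>k\<in>{1..n}. (\<forall>r\<le>d k. h k r \<in> Zq v \<and> h k r = h k (d k - r)) \<and>
        h k 0 = 1 \<and> h k (d k) = 1)"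

definition d_ok :: "nat \<Rightarrow> nat \<Rightarrow> (nat \<Rightarrow> nat) \<Rightarrow> (nat \<Rightarrow> nat \<Rightarrow> int) \<Rightarrow> bool" where
  "d_ok m n d B \<longleftrightarrow> (\<forall>k\<in>{1..n}. d k > 0 \<and> (\<forall>j\<in>{1..m}. int (d k) dvd B j k))"

definition quantum_seed :: "nat \<Rightarrow> nat \<Rightarrow> (nat \<Rightarrow> nat) \<Rightarrow> 'f::division_ring \<Rightarrow> 'f seed \<Rightarrow> bool" where
  "quantum_seed m n d v S = (case S of (X, h, L, B) \<Rightarrow>
      compatible m n L B \<and> h_ok n d v h \<and> d_ok m n d B \<and> qrule m v L X)"

text \<open>F is the skew field of fractions of the quantum torus spanned (over Z[q^(+-1/2)])
by the X(c): v central, v^k X(c) linearly independent over Z (so the coefficient ring is the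
Laurent polynomial ring and the X(c) form a basis), and every element of F is a right fraction.\<close>
definition torus :: "nat \<Rightarrow> 'f::division_ring \<Rightarrow> ((nat \<Rightarrow> int) \<Rightarrow> 'f) \<Rightarrow> 'f set" where
  "torus m v X = subring_gen ({v, inverse v} \<union> {X c |c. zvec m c})"

definition frac_field_of_torus :: "nat \<Rightarrow> 'f::division_ring \<Rightarrow> ((nat \<Rightarrow> int) \<Rightarrow> 'f) \<Rightarrow> bool" where
  "frac_field_of_torus m v X \<longleftrightarrow>
     v \<noteq> 0 \<and> (\<forall>y. v * y = y * v) \<and>
     (\<forall>P a. finite P \<longrightarrow> (\<forall>p\<in>P. zvec m (snd p)) \<longrightarrow>
        (\<Sum>p\<in>P. of_int (a p) * v powi (fst p) * X (snd p)) = 0 \<longrightarrow> (\<forall>p\<in>P. a p = 0)) \<and>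
     (\<forall>y. \<exists>a b. a \<in> torus m v X \<and> b \<in> torus m v X \<and> b \<noteq> 0 \<and> y = a * inverse b)"

definition mut_vec :: "nat \<Rightarrow> (nat \<Rightarrow> nat) \<Rightarrow> (nat \<Rightarrow> nat \<Rightarrow> int) \<Rightarrow> nat \<Rightarrow> nat \<Rightarrow> nat \<Rightarrow> int" where
  "mut_vec m d B i r = (\<lambda>k. if k \<in> {1..m} then
      int r * max (B k i div int (d i)) 0 + int (d i - r) * max (- (B k i div int (d i))) 0
      - unitv i k else 0)"

definition mut_var :: "nat \<Rightarrow> (nat \<Rightarrow> nat) \<Rightarrow> 'f::division_ring seed \<Rightarrow> nat \<Rightarrow> 'f" where
  "mut_var m d S i = (case S of (X, h, L, B) \<Rightarrow>
      (\<Sum>r\<in>{0..d i}. h i r * X (mut_vec m d B i r)))"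

definition Emat :: "int \<Rightarrow> (nat \<Rightarrow> nat \<Rightarrow> int) \<Rightarrow> nat \<Rightarrow> nat \<Rightarrow> nat \<Rightarrow> int" where
  "Emat eps B i = (\<lambda>k l. if l \<noteq> i then (if k = l then 1 else 0)
                         else if k = i then -1 else max (- eps * B k i) 0)"

definition Fmat :: "int \<Rightarrow> (nat \<Rightarrow> nat \<Rightarrow> int) \<Rightarrow> nat \<Rightarrow> nat \<Rightarrow> nat \<Rightarrow> int" where
  "Fmat eps B i = (\<lambda>k l. if k \<noteq> i then (if k = l then 1 else 0)
                         else if l = i then -1 else max (eps * B i l) 0)"

definition mut_Lambda :: "nat \<Rightarrow> int \<Rightarrow> nat \<Rightarrow> (nat \<Rightarrow> nat \<Rightarrow> int) \<Rightarrow> (nat \<Rightarrow> nat \<Rightarrow> int) \<Rightarrow> nat \<Rightarrow> nat \<Rightarrow> int" where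
  "mut_Lambda m eps i L B = (\<lambda>k l. \<Sum>a\<in>{1..m}. \<Sum>b\<in>{1..m}. Emat eps B i a k * L a b * Emat eps B i b l)"

definition mut_B :: "nat \<Rightarrow> nat \<Rightarrow> int \<Rightarrow> nat \<Rightarrow> (nat \<Rightarrow> nat \<Rightarrow> int) \<Rightarrow> nat \<Rightarrow> nat \<Rightarrow> int" where
  "mut_B m n eps i B = (\<lambda>k l. \<Sum>a\<in>{1..m}. \<Sum>b\<in>{1..n}. Emat eps B i k a * B a b * Fmat eps B i b l)"

text \<open>S' is (a representative of) mu_i(S) computed with sign eps: X' is any map obeying the
quasi-commutation rule for the new Lambda with the prescribed values on the basis vectors
(such a map is determined on Z^m by these values).\<close>
definition is_mutation :: "nat \<Rightarrow> nat \<Rightarrow> (nat \<Rightarrow> nat) \<Rightarrow> 'f::division_ring \<Rightarrow> int \<Rightarrow> nat \<Rightarrow> 'f seed \<Rightarrow> 'f seed \<Rightarrow> bool" where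
  "is_mutation m n d v eps i S S' = (case S of (X, h, L, B) \<Rightarrow> case S' of (X', h', L', B') \<Rightarrow>
      h' = h \<and> L' = mut_Lambda m eps i L B \<and> B' = mut_B m n eps i B \<and>
      qrule m v L' X' \<and>
      (\<forall>k\<in>{1..m}. k \<noteq> i \<longrightarrow> X' (unitv k) = X (unitv k)) \<and>
      X' (unitv i) = mut_var m d S i)"

definition mut_step :: "nat \<Rightarrow> nat \<Rightarrow> (nat \<Rightarrow> nat) \<Rightarrow> 'f::division_ring \<Rightarrow> 'f seed \<Rightarrow> 'f seed \<Rightarrow> bool" where
  "mut_step m n d v S S' \<longleftrightarrow> (\<exists>i\<in>{1..n}. \<exists>eps\<in>{1, -1}. is_mutation m n d v eps i S S')"

definition mut_equiv :: "nat \<Rightarrow> nat \<Rightarrow> (nat \<Rightarrow> nat) \<Rightarrow> 'f::division_ring \<Rightarrow> 'f seed \<Rightarrow> 'f seed \<Rightarrow> bool" where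
  "mut_equiv m n d v = (mut_step m n d v)\<^sup>*\<^sup>*"

definition clvar :: "'f seed \<Rightarrow> nat \<Rightarrow> 'f" where
  "clvar S k = (case S of (X, h, L, B) \<Rightarrow> X (unitv k))"

text \<open>ZP[Y_1^(+-1),...,Y_n^(+-1)] where Y_k are the cluster variables (frozen ones Y_(n+1..m) = X_(n+1..m)).\<close>
definition Lring :: "nat \<Rightarrow> 'f::division_ring \<Rightarrow> (nat \<Rightarrow> 'f) \<Rightarrow> 'f set" where
  "Lring m v Y = subring_gen ({v, inverse v} \<union> Y ` {1..m} \<union> (\<lambda>k. inverse (Y k)) ` {1..m})"

definition upper_bound :: "nat \<Rightarrow> nat \<Rightarrow> (nat \<Rightarrow> nat) \<Rightarrow> 'f::division_ring \<Rightarrow> 'f seed \<Rightarrow> 'f set" where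
  "upper_bound m n d v S =
     Lring m v (clvar S) \<inter> (\<Inter>i\<in>{1..n}. Lring m v ((clvar S)(i := mut_var m d S i)))"

definition upper_cluster_algebra :: "nat \<Rightarrow> nat \<Rightarrow> (nat \<Rightarrow> nat) \<Rightarrow> 'f::division_ring \<Rightarrow> 'f seed \<Rightarrow> 'f set" where
  "upper_cluster_algebra m n d v S = (\<Inter>{Lring m v (clvar S') |S'. mut_equiv m n d v S S'})"

definition poly_ring :: "nat \<Rightarrow> nat \<Rightarrow> 'f::division_ring \<Rightarrow> 'f seed \<Rightarrow> 'f set" where
  "poly_ring m n v S = subring_gen ({v, inverse v} \<union> clvar S ` {1..m}
        \<union> (\<lambda>k. inverse (clvar S k)) ` {n+1..m})"

definition coprime_seed :: "nat \<Rightarrow> nat \<Rightarrow> (nat \<Rightarrow> nat) \<Rightarrow> 'f::division_ring \<Rightarrow> 'f seed \<Rightarrow> bool" where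
  "coprime_seed m n d v S \<longleftrightarrow>
     (let R = poly_ring m n v S in
      \<forall>i\<in>{1..n}. \<forall>j\<in>{1..n}. i \<noteq> j \<longrightarrow>
        \<not> (\<exists>c\<in>R. (\<forall>y\<in>R. c * y = y * c) \<and>
               \<not> (\<exists>u\<in>R. c * u = 1 \<and> u * c = 1) \<and>
               (\<exists>a\<in>R. clvar S i * mut_var m d S i = c * a) \<and>
               (\<exists>a\<in>R. clvar S j * mut_var m d S j = c * a)))"

end

theory Submission
  imports Defs "HOL-Library.Function_Algebras"
begin

text \<open>The point is that an element \<open>y\<close> of the Laurent rings of \<open>X\<close>, \<open>mu_i X\<close> and \<open>mu_j X\<close> lies in
  the Laurent ring of \<open>mu_j (mu_i X)\<close>. Compatibility gives \<open>Lambda(c, beta_k) = - c_k D_k / d_k\<close>.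
  Choose a sign \<open>t\<close> with \<open>t b_ij \<le> 0\<close> and grade the torus of \<open>X\<close> by \<open>f = - t Lambda(e_i, -)\<close>.
  Then \<open>f(beta_j) = 0\<close>, so the new variable at \<open>j\<close> is homogeneous, and \<open>t f(beta_i) > 0\<close>, so the
  new variable at \<open>i\<close> has a single lowest monomial \<open>X(E e_i)\<close>; hence, for \<open>c_i \<ge> 0\<close>, the lowest
  term of \<open>X'(c)\<close> is \<open>X(E c)\<close>. The lowest component of \<open>y\<close> is a combination of monomials in
  \<open>X_j\<close> or in the new \<open>j\<close>-variable with nonnegative exponents. After multiplication by a power of
  \<open>X'_i\<close> each of these lifts to the twice mutated torus, because the exchange polynomial at \<open>j\<close>
  after the mutation at \<open>i\<close> has the old one as its lowest term. Subtracting the lift shortens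
  the range of degrees of \<open>y\<close>.\<close>

section \<open>Integer vectors and bilinear forms\<close>

text \<open>The obstacle is that X'(c) is a Laurent polynomial in X only for c_i >= 0: elements of
  the Laurent ring of mu_i X cannot be compared with monomials of X before they are multiplied by a
  power of X'_i. That power can be removed at the end, since X'_i is also a variable of mu_j (mu_i
  X). The condition t b_ij <= 0 makes the matrix E fix coordinate j and carry column j of B to
  column j of the mutated matrix, so the two exchange polynomials at j correspond under E up to a
  translation. The shape of the lowest component comes from \<open>Sp_Int_decomp\<close>: the
  intersection of the Laurent rings before and after one mutation is the sum of their parts with
  nonnegative exponents. The lifts must lie in the Laurent rings of X and mu_j X as well, because
  the remainder has to satisfy the induction hypothesis again. All this yields one inclusion of
  upper bounds; mutation being an involution yields the other.\<close>

definition smul :: "int \<Rightarrow> (nat \<Rightarrow> int) \<Rightarrow> nat \<Rightarrow> int" where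
  "smul r c = (\<lambda>k. r * c k)"

lemma smul_apply: "smul r c k = r * c k"
  by (simp add: smul_def)

text \<open>Higher-order unification introduces eta-expanded vectors, which the pointwise rules would
  destroy; they are therefore not used as default simplification rules.\<close>

declare zero_fun_apply [simp del] plus_fun_apply [simp del] minus_apply [simp del] uminus_apply [simp del]

lemmas vec_apply = zero_fun_apply plus_fun_apply minus_apply uminus_apply smul_apply

lemma smul_simps [simp]: "smul 0 c = 0" "smul 1 c = c" "smul r 0 = 0" "smul (- 1) c = - c"
  by (auto simp: fun_eq_iff vec_apply)

lemma smul_add_left: "smul (r + s) c = smul r c + smul s c"
  by (auto simp: fun_eq_iff vec_apply algebra_simps)

lemma smul_uminus: "smul r (- c) = - smul r c"
  by (simp add: fun_eq_iff vec_apply)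

lemma zvec_0 [simp]: "zvec m 0"
  by (simp add: zvec_def vec_apply)

lemma zvec_add [simp]: "zvec m a \<Longrightarrow> zvec m b \<Longrightarrow> zvec m (a + b)"
  by (simp add: zvec_def vec_apply)

lemma zvec_diff [simp]: "zvec m a \<Longrightarrow> zvec m b \<Longrightarrow> zvec m (a - b)"
  by (simp add: zvec_def vec_apply)

lemma zvec_uminus [simp]: "zvec m a \<Longrightarrow> zvec m (- a)"
  by (simp add: zvec_def vec_apply)

lemma zvec_smul [simp]: "zvec m a \<Longrightarrow> zvec m (smul r a)"
  by (simp add: zvec_def vec_apply)

lemma zvec_unitv [simp]: "k \<in> {1..m} \<Longrightarrow> zvec m (unitv k)"
  by (auto simp: zvec_def unitv_def)

lemma unitv_apply [simp]: "unitv k k = 1" "j \<noteq> k \<Longrightarrow> unitv k j = 0"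
  by (auto simp: unitv_def)

lemma bilin_add_left: "bilin m L (a + b) c = bilin m L a c + bilin m L b c"
  by (simp add: bilin_def vec_apply algebra_simps sum.distrib)

lemma bilin_add_right: "bilin m L c (a + b) = bilin m L c a + bilin m L c b"
  by (simp add: bilin_def vec_apply algebra_simps sum.distrib)

lemma bilin_smul_left: "bilin m L (smul r a) c = r * bilin m L a c"
  by (simp add: bilin_def vec_apply sum_distrib_left mult.assoc)

lemma bilin_smul_right: "bilin m L c (smul r a) = r * bilin m L c a"
  by (simp add: bilin_def vec_apply sum_distrib_left algebra_simps)

lemma bilin_uminus_left: "bilin m L (- a) c = - bilin m L a c"
  using bilin_smul_left[of m L "-1" a c] by simp

lemma bilin_uminus_right: "bilin m L c (- a) = - bilin m L c a"
  using bilin_smul_right[of m L c "-1" a] by simp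

lemma bilin_diff_left: "bilin m L (a - b) c = bilin m L a c - bilin m L b c"
  using bilin_add_left[of m L a "- b" c] by (simp add: bilin_uminus_left)

lemma bilin_diff_right: "bilin m L c (a - b) = bilin m L c a - bilin m L c b"
  using bilin_add_right[of m L c a "- b"] by (simp add: bilin_uminus_right)

lemma bilin_0 [simp]: "bilin m L 0 c = 0" "bilin m L c 0 = 0"
  by (simp_all add: bilin_def vec_apply)

lemmas bilin_linear = bilin_add_left bilin_add_right bilin_smul_left bilin_smul_right
  bilin_uminus_left bilin_uminus_right bilin_diff_left bilin_diff_right

lemma bilin_unitv:
  assumes "k \<in> {1..m}" "l \<in> {1..m}"
  shows "bilin m L (unitv k) (unitv l) = L k l"
proof -
  have "bilin m L (unitv k) (unitv l) = (\<Sum>a\<in>{1..m}. \<Sum>b\<in>{1..m}. if b = l then (if a = k then L a b else 0) else 0)"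
    unfolding bilin_def unitv_def by (intro sum.cong) auto
  also have "\<dots> = L k l"
    using assms by (simp add: sum.delta)
  finally show ?thesis .
qed

lemma bilin_skew:
  assumes "\<forall>k\<in>{1..m}. \<forall>l\<in>{1..m}. L k l = - L l k"
  shows "bilin m L a b = - bilin m L b a"
proof -
  have "bilin m L a b = (\<Sum>k\<in>{1..m}. \<Sum>l\<in>{1..m}. - (b l * L l k * a k))"
    unfolding bilin_def
  proof (intro sum.cong refl)
    fix k l assume "k \<in> {1..m}" "l \<in> {1..m}"
    then have "L k l = - L l k" using assms by blast
    then show "a k * L k l * b l = - (b l * L l k * a k)" by simp
  qed
  also have "\<dots> = - bilin m L b a"
    unfolding bilin_def by (subst sum.swap) (simp add: sum_negf)
  finally show ?thesis .
qed

text \<open>The sign conditions make every step move away from 0. A coordinate that is 0 in the end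
  has therefore never been touched, which is what \<open>X1_off\<close> relies on.\<close>

lemma zvec_induct [consumes 1, case_names zero plus minus]:
  assumes "zvec m c"
    and "P 0"
    and plus: "\<And>c k. k \<in> {1..m} \<Longrightarrow> zvec m c \<Longrightarrow> c k \<ge> 0 \<Longrightarrow> P c \<Longrightarrow> P (c + unitv k)"
    and minus: "\<And>c k. k \<in> {1..m} \<Longrightarrow> zvec m c \<Longrightarrow> c k \<le> 0 \<Longrightarrow> P c \<Longrightarrow> P (c - unitv k)"
  shows "P c"
  using assms(1)
proof (induction "\<Sum>k\<in>{1..m}. nat \<bar>c k\<bar>" arbitrary: c rule: less_induct)
  case less
  have smaller: "(\<Sum>j\<in>{1..m}. nat \<bar>e j\<bar>) < (\<Sum>j\<in>{1..m}. nat \<bar>c j\<bar>)"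
    if "k \<in> {1..m}" "\<bar>e k\<bar> < \<bar>c k\<bar>" "\<And>j. j \<noteq> k \<Longrightarrow> e j = c j" for e k
  proof (rule sum_strict_mono_ex1)
    show "\<forall>j\<in>{1..m}. nat \<bar>e j\<bar> \<le> nat \<bar>c j\<bar>"
    proof
      fix j
      show "nat \<bar>e j\<bar> \<le> nat \<bar>c j\<bar>"
        using that(2) that(3)[of j] by (cases "j = k") auto
    qed
    show "\<exists>j\<in>{1..m}. nat \<bar>e j\<bar> < nat \<bar>c j\<bar>"
      using that(1,2) by (auto intro!: bexI[of _ k])
  qed simp
  show ?case
  proof (cases "c = 0")
    case True
    then show ?thesis using assms(2) by simp
  next
    case False
    then obtain k where k: "c k \<noteq> 0" by (auto simp: fun_eq_iff vec_apply)
    then have km: "k \<in> {1..m}" using less.prems by (auto simp: zvec_def)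
    show ?thesis
    proof (cases "c k > 0")
      case True
      have "P (c - unitv k)"
        using True less.prems km by (intro less.hyps smaller[OF km]) (auto simp: vec_apply)
      then have "P ((c - unitv k) + unitv k)"
        using True less.prems km by (intro plus) (auto simp: vec_apply)
      then show ?thesis by simp
    next
      case f: False
      have "P (c + unitv k)"
        using f k less.prems km by (intro less.hyps smaller[OF km]) (auto simp: vec_apply)
      then have "P ((c + unitv k) - unitv k)"
        using f k less.prems km by (intro minus) (auto simp: vec_apply)
      then show ?thesis by simp
    qed
  qed
qed

section \<open>Spans of monomials\<close>

locale central_unit =
  fixes m :: nat and v :: "'f::division_ring"
  assumes v_nz: "v \<noteq> 0" and v_comm: "v * y = y * v"
begin

lemma inverse_v_comm: "inverse v * y = y * inverse v"
proof -
  have "inverse v * y = inverse v * (y * v) * inverse v"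
    using v_nz by (simp add: mult.assoc)
  also have "\<dots> = y * inverse v"
    using v_nz by (simp add: v_comm[symmetric] mult.assoc[symmetric])
  finally show ?thesis .
qed

lemma Zq_comm: "a \<in> Zq v \<Longrightarrow> a * y = y * a"
  unfolding Zq_def
proof (induction arbitrary: y rule: subring_gen.induct)
  case (gen x)
  then show ?case using v_comm inverse_v_comm by auto
next
  case (mult x z)
  then show ?case by (metis mult.assoc)
qed (simp_all add: algebra_simps)

lemma Zq_closed [intro, simp]:
  "0 \<in> Zq v" "1 \<in> Zq v" "a \<in> Zq v \<Longrightarrow> b \<in> Zq v \<Longrightarrow> a + b \<in> Zq v"
  "a \<in> Zq v \<Longrightarrow> - a \<in> Zq v" "a \<in> Zq v \<Longrightarrow> b \<in> Zq v \<Longrightarrow> a * b \<in> Zq v"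
  unfolding Zq_def by (auto intro: subring_gen.intros)

lemma Zq_diff [intro, simp]: "a \<in> Zq v \<Longrightarrow> b \<in> Zq v \<Longrightarrow> a - b \<in> Zq v"
  using Zq_closed(3)[of a "- b"] Zq_closed(4)[of b] by simp

lemma Zq_v [intro, simp]: "v \<in> Zq v" "inverse v \<in> Zq v"
  unfolding Zq_def by (auto intro: subring_gen.intros)

lemma Zq_power: "a \<in> Zq v \<Longrightarrow> a ^ k \<in> Zq v"
  by (induction k) auto

lemma Zq_powi [intro, simp]: "v powi k \<in> Zq v"
  by (auto simp: power_int_def intro: Zq_power)

lemma vp_nz [simp]: "v powi k \<noteq> 0"
  using v_nz by simp

lemma vp_add: "v powi (k + l) = v powi k * v powi l"
  using v_nz by (simp add: power_int_add)

lemma vp_comm: "v powi k * y = y * v powi k"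
  by (rule Zq_comm) simp

text \<open>The Zq-span of the monomials with exponent in \<open>S\<close>; exponents outside Z^m are ignored.\<close>

inductive_set Sp :: "((nat \<Rightarrow> int) \<Rightarrow> 'f) \<Rightarrow> (nat \<Rightarrow> int) set \<Rightarrow> 'f set"
  for X :: "(nat \<Rightarrow> int) \<Rightarrow> 'f" and S :: "(nat \<Rightarrow> int) set" where
  zero: "0 \<in> Sp X S"
| step: "a \<in> Zq v \<Longrightarrow> c \<in> S \<Longrightarrow> zvec m c \<Longrightarrow> y \<in> Sp X S \<Longrightarrow> a * X c + y \<in> Sp X S"

lemma Sp_monom: "a \<in> Zq v \<Longrightarrow> c \<in> S \<Longrightarrow> zvec m c \<Longrightarrow> a * X c \<in> Sp X S"
  using Sp.step[OF _ _ _ Sp.zero] by fastforce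

lemma Sp_X: "c \<in> S \<Longrightarrow> zvec m c \<Longrightarrow> X c \<in> Sp X S"
  using Sp_monom[of 1 c S X] by simp

lemma Sp_add: "x \<in> Sp X S \<Longrightarrow> y \<in> Sp X S \<Longrightarrow> x + y \<in> Sp X S"
  by (induction rule: Sp.induct) (auto simp: add.assoc intro: Sp.intros)

lemma Sp_scale: "x \<in> Sp X S \<Longrightarrow> a \<in> Zq v \<Longrightarrow> a * x \<in> Sp X S"
proof (induction rule: Sp.induct)
  case (step b c y)
  then have "(a * b) * X c + a * y \<in> Sp X S"
    by (intro Sp.step) auto
  then show ?case by (simp add: algebra_simps)
qed (auto intro: Sp.zero)

lemma Sp_uminus: "x \<in> Sp X S \<Longrightarrow> - x \<in> Sp X S"
  using Sp_scale[of x X S "-1"] by auto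

lemma Sp_diff: "x \<in> Sp X S \<Longrightarrow> y \<in> Sp X S \<Longrightarrow> x - y \<in> Sp X S"
  using Sp_add[of x X S "- y"] Sp_uminus[of y X S] by simp

lemma Sp_sum: "(\<And>k. k \<in> K \<Longrightarrow> f k \<in> Sp X S) \<Longrightarrow> sum f K \<in> Sp X S"
  by (induction K rule: infinite_finite_induct) (auto intro: Sp.zero Sp_add)

lemma Sp_mono: "x \<in> Sp X S \<Longrightarrow> (\<And>c. zvec m c \<Longrightarrow> c \<in> S \<Longrightarrow> c \<in> S') \<Longrightarrow> x \<in> Sp X S'"
  by (induction rule: Sp.induct) (auto intro: Sp.intros)

text \<open>The way from one cluster to another: only expansions of single monomials have to be
  known.\<close>

lemma Sp_map: "x \<in> Sp X S \<Longrightarrow> (\<And>c. zvec m c \<Longrightarrow> c \<in> S \<Longrightarrow> X c \<in> Sp X' S') \<Longrightarrow> x \<in> Sp X' S'"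
  by (induction rule: Sp.induct) (auto intro: Sp.intros Sp_add Sp_scale)

lemma Sp_split:
  "y \<in> Sp X S \<Longrightarrow> \<exists>y1 y2. y1 \<in> Sp X {c\<in>S. P c} \<and> y2 \<in> Sp X {c\<in>S. \<not> P c} \<and> y = y1 + y2"
proof (induction rule: Sp.induct)
  case zero
  show ?case by (auto intro!: exI[of _ 0] Sp.zero)
next
  case (step a c y)
  then obtain y1 y2 where y: "y1 \<in> Sp X {c\<in>S. P c}" "y2 \<in> Sp X {c\<in>S. \<not> P c}" "y = y1 + y2"
    by blast
  show ?case
  proof (cases "P c")
    case True
    then show ?thesis using step y
      by (intro exI[of _ "a * X c + y1"] exI[of _ y2]) (auto intro: Sp.step simp: add.assoc)
  next
    case False
    then have "a * X c + y2 \<in> Sp X {c\<in>S. \<not> P c}"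
      using step y by (intro Sp.step) auto
    moreover have "a * X c + y = y1 + (a * X c + y2)"
      using y by (simp add: algebra_simps)
    ultimately show ?thesis using y(1) by blast
  qed
qed

text \<open>Only finitely many monomials occur. This supplies the clearing powers of X'_i and the
  finite ranges of degrees for the inductions.\<close>

lemma Sp_bounded:
  fixes f :: "(nat \<Rightarrow> int) \<Rightarrow> int"
  shows "y \<in> Sp X S \<Longrightarrow> \<exists>N::nat. y \<in> Sp X {c\<in>S. \<bar>f c\<bar> \<le> int N}"
proof (induction rule: Sp.induct)
  case zero
  show ?case by (auto intro: Sp.zero)
next
  case (step a c y)
  then obtain N :: nat where N: "y \<in> Sp X {c\<in>S. \<bar>f c\<bar> \<le> int N}" by blast
  let ?M = "max N (nat \<bar>f c\<bar>)"
  have "y \<in> Sp X {c\<in>S. \<bar>f c\<bar> \<le> int ?M}"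
    using N by (rule Sp_mono) auto
  then have "a * X c + y \<in> Sp X {c\<in>S. \<bar>f c\<bar> \<le> int ?M}"
    using step by (intro Sp.step) auto
  then show ?case by blast
qed

text \<open>Coefficients extended by 0 outside \<open>C\<close> let two expansions be compared on
  the union of their supports, as in \<open>Sp_Int\<close>.\<close>

lemma Sp_repr:
  "y \<in> Sp X S \<Longrightarrow> \<exists>C a. finite C \<and> C \<subseteq> S \<and> (\<forall>c\<in>C. zvec m c) \<and> (\<forall>c. a c \<in> Zq v)
     \<and> (\<forall>c. c \<notin> C \<longrightarrow> a c = 0) \<and> y = (\<Sum>c\<in>C. a c * X c)"
proof (induction rule: Sp.induct)
  case zero
  show ?case by (auto intro!: exI[of _ "{}"] exI[of _ "\<lambda>_. 0"])
next
  case (step b e y)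
  then obtain C a where C: "finite C" "C \<subseteq> S" "\<forall>c\<in>C. zvec m c" "\<forall>c. a c \<in> Zq v"
     "\<forall>c. c \<notin> C \<longrightarrow> a c = 0" "y = (\<Sum>c\<in>C. a c * X c)" by blast
  let ?a = "a(e := b + a e)"
  have y: "y = (\<Sum>c\<in>insert e C. a c * X c)"
    using C by (auto simp: sum.insert_if)
  have "b * X e + y = (\<Sum>c\<in>insert e C. ?a c * X c)"
    unfolding y using C(1)
    by (simp add: sum.insert_remove algebra_simps)
  then show ?case using C step
    by (intro exI[of _ "insert e C"] exI[of _ ?a]) auto
qed

lemma Sp_sumI: "(\<And>c. c \<in> C \<Longrightarrow> a c \<in> Zq v \<and> zvec m c \<and> c \<in> S) \<Longrightarrow> (\<Sum>c\<in>C. a c * X c) \<in> Sp X S"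
  by (intro Sp_sum Sp_monom) auto

text \<open>The coefficients range over the whole ring generated by v and 1/v, so the
  \<open>X c\<close> form a basis of their span over it. In this form the property is inherited by
  mutated seeds (\<open>indep1\<close>).\<close>

definition indep :: "((nat \<Rightarrow> int) \<Rightarrow> 'f) \<Rightarrow> bool" where
  "indep X \<longleftrightarrow> (\<forall>C a. finite C \<longrightarrow> (\<forall>c\<in>C. zvec m c) \<longrightarrow> (\<forall>c\<in>C. a c \<in> Zq v) \<longrightarrow>
     (\<Sum>c\<in>C. a c * X c) = 0 \<longrightarrow> (\<forall>c\<in>C. a c = 0))"

lemma indepD:
  "indep X \<Longrightarrow> finite C \<Longrightarrow> (\<And>c. c \<in> C \<Longrightarrow> zvec m c) \<Longrightarrow> (\<And>c. c \<in> C \<Longrightarrow> a c \<in> Zq v) \<Longrightarrow>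
     (\<Sum>c\<in>C. a c * X c) = 0 \<Longrightarrow> c \<in> C \<Longrightarrow> a c = 0"
  unfolding indep_def by blast

lemma Sp_Int:
  assumes "indep X" "y \<in> Sp X S" "y \<in> Sp X S'"
  shows "y \<in> Sp X (S \<inter> S')"
proof -
  obtain C a where C: "finite C" "C \<subseteq> S" "\<forall>c\<in>C. zvec m c" "\<forall>c. a c \<in> Zq v"
     "\<forall>c. c \<notin> C \<longrightarrow> a c = 0" "y = (\<Sum>c\<in>C. a c * X c)" using Sp_repr[OF assms(2)] by blast
  obtain D b where D: "finite D" "D \<subseteq> S'" "\<forall>c\<in>D. zvec m c" "\<forall>c. b c \<in> Zq v"
     "\<forall>c. c \<notin> D \<longrightarrow> b c = 0" "y = (\<Sum>c\<in>D. b c * X c)" using Sp_repr[OF assms(3)] by blast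
  have yC: "y = (\<Sum>c\<in>C \<union> D. a c * X c)"
    unfolding C(6) using C D by (intro sum.mono_neutral_left) auto
  have yD: "y = (\<Sum>c\<in>C \<union> D. b c * X c)"
    unfolding D(6) using C D by (intro sum.mono_neutral_left) auto
  have "(\<Sum>c\<in>C \<union> D. (a c - b c) * X c) = y - y"
    by (subst (1) yC, subst yD) (simp add: sum_subtractf left_diff_distrib)
  then have eq: "a c = b c" if "c \<in> C \<union> D" for c
  proof -
    have "zvec m e" if "e \<in> C \<union> D" for e
      using C(3) D(3) that by auto
    then have "a c - b c = 0"
      using indepD[OF assms(1), of "C \<union> D" "\<lambda>c. a c - b c" c] C D \<open>c \<in> C \<union> D\<close> 
        \<open>(\<Sum>c\<in>C \<union> D. (a c - b c) * X c) = y - y\<close> by fastforce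
    then show ?thesis by simp
  qed
  have "y = (\<Sum>c\<in>C \<inter> D. a c * X c)"
    unfolding C(6) using C(1,5) D(5) eq by (intro sum.mono_neutral_right) auto
  then show ?thesis using C D by (auto intro!: Sp_sumI)
qed

lemma Sp_empty: "y \<in> Sp X {} \<Longrightarrow> y = 0"
  by (induction rule: Sp.induct) auto

lemma Sp_disjoint: "indep X \<Longrightarrow> y \<in> Sp X S \<Longrightarrow> y \<in> Sp X S' \<Longrightarrow> S \<inter> S' = {} \<Longrightarrow> y = 0"
  using Sp_Int Sp_empty by metis

lemma indep_nz: "indep X \<Longrightarrow> zvec m c \<Longrightarrow> X c \<noteq> 0"
  using indepD[of X "{c}" "\<lambda>_. 1" c] by auto

lemma qruleD: "qrule m v L X \<Longrightarrow> zvec m c \<Longrightarrow> zvec m e \<Longrightarrow> X c * X e = v powi bilin m L c e * X (c + e)"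
  unfolding qrule_def plus_fun_def by blast

lemma qrule_add:
  assumes "qrule m v L X" "zvec m c" "zvec m e"
  shows "X (c + e) = v powi (- bilin m L c e) * (X c * X e)"
  using qruleD[OF assms] v_nz by (simp add: power_int_minus mult.assoc[symmetric])

lemma Sp_mult:
  assumes "qrule m v L X" "x \<in> Sp X S" "y \<in> Sp X S'"
    and *: "\<And>c e. zvec m c \<Longrightarrow> zvec m e \<Longrightarrow> c \<in> S \<Longrightarrow> e \<in> S' \<Longrightarrow> c + e \<in> S''"
  shows "x * y \<in> Sp X S''"
  using assms(2)
proof (induction rule: Sp.induct)
  case zero
  show ?case by (simp add: Sp.zero)
next
  case (step a c x)
  have "X c * y \<in> Sp X S''"
    using assms(3)
  proof (induction rule: Sp.induct)
    case (step b e y)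
    have "X c * (b * X e + y) = b * (X c * X e) + X c * y"
      using Zq_comm[OF step(1), of "X c"] by (simp add: distrib_left mult.assoc[symmetric])
    also have "\<dots> = (b * v powi bilin m L c e) * X (c + e) + X c * y"
      using qruleD[OF assms(1) \<open>zvec m c\<close> step(3)] by (simp add: mult.assoc)
    finally show ?case
      using step \<open>zvec m c\<close> \<open>c \<in> S\<close> * by (auto intro!: Sp.step)
  qed (simp add: Sp.zero)
  then show ?case using step Sp_scale Sp_add by (simp add: distrib_right mult.assoc)
qed

text \<open>The zero map obeys \<open>qrule\<close> as well, hence the second assumption; it makes
  \<open>X 0\<close> a nonzero idempotent.\<close>

lemma qrule_zero:
  assumes "qrule m v L X" "X 0 \<noteq> 0"
  shows "X 0 = 1"
  using qruleD[OF assms(1), of 0 0] assms(2) by simp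

lemma qrule_nz:
  assumes "qrule m v L X" "X 0 \<noteq> 0" "zvec m c"
  shows "X c \<noteq> 0"
  using qruleD[OF assms(1,3), of "- c"] assms(2,3) v_nz by auto

lemma qrule_uminus:
  assumes "qrule m v L X" "X 0 \<noteq> 0" "zvec m c" "bilin m L c c = 0"
  shows "X (- c) = inverse (X c)"
proof -
  have "X c * X (- c) = 1"
    using qruleD[OF assms(1,3), of "- c"] assms qrule_zero[OF assms(1,2)] by (simp add: bilin_linear)
  then show ?thesis
    by (simp add: inverse_unique)
qed

text \<open>Trades the presentation by generators for spans, where exponents can be controlled.
  \<open>qrule\<close> closes the span under products, and induction on the exponent builds each
  monomial from the generators.\<close>

lemma Lring_eq_Sp:
  assumes q: "qrule m v L X" and 0: "X 0 \<noteq> 0"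
    and skew: "\<forall>k\<in>{1..m}. \<forall>l\<in>{1..m}. L k l = - L l k"
    and Y: "\<And>k. k \<in> {1..m} \<Longrightarrow> Y k = X (unitv k)"
  shows "Lring m v Y = Sp X UNIV"
proof
  have bs: "bilin m L c c = 0" for c
    using bilin_skew[OF skew, of c c] by simp
  have X1: "1 \<in> Sp X UNIV"
    using Sp_X[of 0 UNIV X] qrule_zero[OF q 0] by simp
  show "Lring m v Y \<subseteq> Sp X UNIV"
  proof
    fix y assume "y \<in> Lring m v Y"
    then show "y \<in> Sp X UNIV"
      unfolding Lring_def
    proof (induction rule: subring_gen.induct)
      case (gen x)
      then consider "x \<in> Zq v" | k where "k \<in> {1..m}" "x = X (unitv k)"
        | k where "k \<in> {1..m}" "x = X (- unitv k)"
        using Y qrule_uminus[OF q 0 _ bs] by auto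
      then show ?case
      proof cases
        case 1
        then show ?thesis using Sp_scale[OF X1] by fastforce
      qed (auto intro!: Sp_X)
    next
      case (mult x y)
      then show ?case by (intro Sp_mult[OF q, of x UNIV y UNIV]) auto
    qed (auto intro: Sp.zero X1 Sp_add Sp_uminus)
  qed
  have vL: "v powi k \<in> Lring m v Y" for k
  proof -
    have "v ^ k \<in> Lring m v Y" "inverse v ^ k \<in> Lring m v Y" for k :: nat
      by (induction k) (auto simp: Lring_def intro: subring_gen.intros)
    then show ?thesis by (simp add: power_int_def)
  qed
  have AL: "a \<in> Lring m v Y" if "a \<in> Zq v" for a
    using that unfolding Zq_def
    by (induction rule: subring_gen.induct) (auto simp: Lring_def intro: subring_gen.intros)
  have XL: "X c \<in> Lring m v Y" if "zvec m c" for c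
    using that
  proof (induction rule: zvec_induct)
    case zero
    then show ?case using qrule_zero[OF q 0] by (auto simp: Lring_def intro: subring_gen.intros)
  next
    case (plus c k)
    have "X (unitv k) \<in> Lring m v Y"
      using Y[OF plus(1), symmetric] plus(1) unfolding Lring_def by (intro subring_gen.gen) auto
    then show ?case
      using plus vL qrule_add[OF q, of c "unitv k"] by (auto simp: Lring_def intro!: subring_gen.mult)
  next
    case (minus c k)
    have "X (- unitv k) = inverse (Y k)"
      using Y[OF minus(1)] minus(1) qrule_uminus[OF q 0 _ bs] by simp
    then have "X (- unitv k) \<in> Lring m v Y"
      using minus(1) unfolding Lring_def by (intro subring_gen.gen) auto
    then have "X (c + - unitv k) \<in> Lring m v Y"
      using minus vL qrule_add[OF q, of c "- unitv k"] by (auto simp: Lring_def intro!: subring_gen.mult)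
    then show ?case by simp
  qed
  show "Sp X UNIV \<subseteq> Lring m v Y"
  proof
    fix y assume "y \<in> Sp X UNIV"
    then show "y \<in> Lring m v Y"
    proof (induction rule: Sp.induct)
      case zero
      then show ?case by (auto simp: Lring_def intro: subring_gen.intros)
    next
      case (step a c y)
      then show ?case using AL XL by (auto simp: Lring_def intro!: subring_gen.add subring_gen.mult)
    qed
  qed
qed

end

section \<open>Compatible pairs\<close>

definition colv :: "nat \<Rightarrow> (nat \<Rightarrow> nat \<Rightarrow> int) \<Rightarrow> nat \<Rightarrow> nat \<Rightarrow> int" where
  "colv m B l = (\<lambda>k. if k \<in> {1..m} then B k l else 0)"

definition betav :: "nat \<Rightarrow> (nat \<Rightarrow> nat) \<Rightarrow> (nat \<Rightarrow> nat \<Rightarrow> int) \<Rightarrow> nat \<Rightarrow> nat \<Rightarrow> int" where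
  "betav m d B l = (\<lambda>k. if k \<in> {1..m} then B k l div int (d l) else 0)"

text \<open>The action of the matrix E of the mutation at \<open>i\<close> with sign \<open>t\<close> on vectors.\<close>

definition Evec :: "nat \<Rightarrow> int \<Rightarrow> (nat \<Rightarrow> nat \<Rightarrow> int) \<Rightarrow> nat \<Rightarrow> (nat \<Rightarrow> int) \<Rightarrow> nat \<Rightarrow> int" where
  "Evec m t B i c = (\<lambda>k. if k = i then - c i
     else if k \<in> {1..m} then c k + max (- t * B k i) 0 * c i else c k)"

lemma zvec_colv [simp]: "zvec m (colv m B l)"
  by (simp add: zvec_def colv_def)

lemma zvec_betav [simp]: "zvec m (betav m d B l)"
  by (simp add: zvec_def betav_def)

lemma zvec_Evec [simp]: "zvec m c \<Longrightarrow> zvec m (Evec m t B i c)"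
  by (auto simp: zvec_def Evec_def)

lemma Evec_at [simp]: "Evec m t B i c i = - c i"
  by (simp add: Evec_def)

lemma Evec_add: "Evec m t B i (a + b) = Evec m t B i a + Evec m t B i b"
  by (auto simp: Evec_def fun_eq_iff vec_apply algebra_simps)

lemma Evec_diff: "Evec m t B i (a - b) = Evec m t B i a - Evec m t B i b"
  by (auto simp: Evec_def fun_eq_iff vec_apply algebra_simps)

lemma Evec_smul: "Evec m t B i (smul r a) = smul r (Evec m t B i a)"
  by (auto simp: Evec_def fun_eq_iff vec_apply algebra_simps)

lemma Evec_uminus: "Evec m t B i (- a) = - Evec m t B i a"
  by (auto simp: Evec_def fun_eq_iff vec_apply)

lemmas Evec_linear = Evec_add Evec_diff Evec_smul Evec_uminus

lemma Evec_Evec [simp]: "Evec m t B i (Evec m t B i c) = c"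
  by (auto simp: Evec_def fun_eq_iff)

lemma Evec_fix: "c i = 0 \<Longrightarrow> Evec m t B i c = c"
  by (auto simp: Evec_def fun_eq_iff)

lemma Emat_sum:
  assumes "i \<in> {1..m}" "k \<in> {1..m}"
  shows "(\<Sum>a\<in>{1..m}. Emat t B i k a * f a)
     = (if k = i then - f i else f k + max (- t * B k i) 0 * f i)"
proof -
  have "(\<Sum>a\<in>{1..m}. Emat t B i k a * f a)
     = Emat t B i k i * f i + (\<Sum>a\<in>{1..m}-{i}. Emat t B i k a * f a)"
    using assms by (simp add: sum.remove)
  also have "(\<Sum>a\<in>{1..m}-{i}. Emat t B i k a * f a) = (\<Sum>a\<in>{1..m}-{i}. if a = k then f a else 0)"
    by (intro sum.cong) (auto simp: Emat_def)
  also have "\<dots> = (if k = i then 0 else f k)"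
    using assms by (auto simp: sum.delta)
  finally show ?thesis by (auto simp: Emat_def)
qed

lemma Emat_sum_vec:
  assumes "i \<in> {1..m}" "k \<in> {1..m}"
  shows "(\<Sum>a\<in>{1..m}. Emat t B i k a * c a) = Evec m t B i c k"
  using Emat_sum[OF assms] assms by (auto simp: Evec_def)

lemma Fmat_sum:
  assumes "i \<in> {1..n}" "l \<in> {1..n}"
  shows "(\<Sum>b\<in>{1..n}. f b * Fmat t B i b l)
     = (if l = i then - f i else f l + f i * max (t * B i l) 0)"
proof -
  have "(\<Sum>b\<in>{1..n}. f b * Fmat t B i b l)
     = f i * Fmat t B i i l + (\<Sum>b\<in>{1..n}-{i}. f b * Fmat t B i b l)"
    using assms by (simp add: sum.remove)
  also have "(\<Sum>b\<in>{1..n}-{i}. f b * Fmat t B i b l) = (\<Sum>b\<in>{1..n}-{i}. if b = l then f b else 0)"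
    by (intro sum.cong) (auto simp: Fmat_def)
  also have "\<dots> = (if l = i then 0 else f l)"
    using assms by (auto simp: sum.delta)
  finally show ?thesis by (auto simp: Fmat_def)
qed

lemma bilin_mut_Lambda:
  assumes "i \<in> {1..m}"
  shows "bilin m (mut_Lambda m t i L B) c e = bilin m L (Evec m t B i c) (Evec m t B i e)"
proof -
  let ?E = "Emat t B i" and ?I = "{1..m}"
  have "bilin m (mut_Lambda m t i L B) c e
     = (\<Sum>k\<in>?I. \<Sum>l\<in>?I. \<Sum>a\<in>?I. \<Sum>b\<in>?I. (?E a k * c k) * L a b * (?E b l * e l))"
    unfolding bilin_def mut_Lambda_def by (simp add: sum_distrib_left sum_distrib_right algebra_simps)
  also have "\<dots> = (\<Sum>k\<in>?I. \<Sum>a\<in>?I. \<Sum>l\<in>?I. \<Sum>b\<in>?I. (?E a k * c k) * L a b * (?E b l * e l))"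
    by (intro sum.cong refl sum.swap)
  also have "\<dots> = (\<Sum>a\<in>?I. \<Sum>k\<in>?I. \<Sum>l\<in>?I. \<Sum>b\<in>?I. (?E a k * c k) * L a b * (?E b l * e l))"
    by (rule sum.swap)
  also have "\<dots> = (\<Sum>a\<in>?I. \<Sum>k\<in>?I. \<Sum>b\<in>?I. \<Sum>l\<in>?I. (?E a k * c k) * L a b * (?E b l * e l))"
    by (intro sum.cong refl sum.swap)
  also have "\<dots> = (\<Sum>a\<in>?I. \<Sum>b\<in>?I. \<Sum>k\<in>?I. \<Sum>l\<in>?I. (?E a k * c k) * L a b * (?E b l * e l))"
    by (intro sum.cong refl sum.swap)
  also have "\<dots> = (\<Sum>a\<in>?I. \<Sum>b\<in>?I. (\<Sum>k\<in>?I. ?E a k * c k) * L a b * (\<Sum>l\<in>?I. ?E b l * e l))"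
  proof (intro sum.cong refl)
    fix a b
    have "(\<Sum>k\<in>?I. ?E a k * c k) * L a b * (\<Sum>l\<in>?I. ?E b l * e l)
       = (\<Sum>k\<in>?I. ?E a k * c k * L a b) * (\<Sum>l\<in>?I. ?E b l * e l)"
      by (simp only: sum_distrib_right)
    also have "\<dots> = (\<Sum>k\<in>?I. \<Sum>l\<in>?I. (?E a k * c k) * L a b * (?E b l * e l))"
      by (rule sum_product)
    finally show "(\<Sum>k\<in>?I. \<Sum>l\<in>?I. (?E a k * c k) * L a b * (?E b l * e l))
       = (\<Sum>k\<in>?I. ?E a k * c k) * L a b * (\<Sum>l\<in>?I. ?E b l * e l)" by simp
  qed
  also have "\<dots> = bilin m L (Evec m t B i c) (Evec m t B i e)"
    unfolding bilin_def by (intro sum.cong refl) (simp only: Emat_sum_vec[OF assms])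
  finally show ?thesis .
qed

lemma mut_B_eq:
  assumes "i \<in> {1..n}" "n \<le> m" "k \<in> {1..m}" "l \<in> {1..n}"
  shows "mut_B m n t i B k l
     = Evec m t B i (if l = i then - colv m B i
         else colv m B l + smul (max (t * B i l) 0) (colv m B i)) k"
proof -
  have i: "i \<in> {1..m}" using assms by auto
  have "mut_B m n t i B k l = (\<Sum>a\<in>{1..m}. Emat t B i k a * (\<Sum>b\<in>{1..n}. B a b * Fmat t B i b l))"
    unfolding mut_B_def by (simp add: sum_distrib_left mult.assoc)
  also have "\<dots> = (\<Sum>a\<in>{1..m}. Emat t B i k a * (if l = i then - colv m B i
         else colv m B l + smul (max (t * B i l) 0) (colv m B i)) a)"
    by (intro sum.cong refl, subst Fmat_sum[OF assms(1,4)]) (auto simp: colv_def vec_apply)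
  also have "\<dots> = Evec m t B i (if l = i then - colv m B i
         else colv m B l + smul (max (t * B i l) 0) (colv m B i)) k"
    by (rule Emat_sum_vec[OF i assms(3)])
  finally show ?thesis .
qed

lemma colv_mut_B:
  assumes "i \<in> {1..n}" "n \<le> m" "l \<in> {1..n}"
  shows "colv m (mut_B m n t i B) l
     = Evec m t B i (if l = i then - colv m B i
         else colv m B l + smul (max (t * B i l) 0) (colv m B i))"
proof
  fix k
  show "colv m (mut_B m n t i B) l k
     = Evec m t B i (if l = i then - colv m B i
         else colv m B l + smul (max (t * B i l) 0) (colv m B i)) k"
  proof (cases "k \<in> {1..m}")
    case True
    then show ?thesis using mut_B_eq[OF assms(1,2) True assms(3)] by (simp add: colv_def)
  next
    case False
    have "zvec m (Evec m t B i (if l = i then - colv m B i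
         else colv m B l + smul (max (t * B i l) 0) (colv m B i)))"
      by simp
    then show ?thesis using False by (auto simp: colv_def zvec_def)
  qed
qed

lemma max_pos_neg: "max (x::int) 0 - max (- x) 0 = x"
  by auto

locale compat_pair =
  fixes m n :: nat and d :: "nat \<Rightarrow> nat" and L B :: "nat \<Rightarrow> nat \<Rightarrow> int"
  assumes nm: "n \<le> m" and compat: "compatible m n L B" and dok: "d_ok m n d B"
begin

lemma skew: "bilin m L a b = - bilin m L b a"
  using compat unfolding compatible_def by (intro bilin_skew) blast

lemma bilin_self [simp]: "bilin m L a a = 0"
  using skew[of a a] by simp

definition D :: "nat \<Rightarrow> int" where
  "D = (SOME D. (\<forall>k\<in>{1..n}. D k > 0) \<and>
        (\<forall>k\<in>{1..m}. \<forall>l\<in>{1..n}. (\<Sum>j\<in>{1..m}. L k j * B j l) = (if k = l then - D k else 0)))"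

lemma D_prop: "(\<forall>k\<in>{1..n}. D k > 0) \<and>
        (\<forall>k\<in>{1..m}. \<forall>l\<in>{1..n}. (\<Sum>j\<in>{1..m}. L k j * B j l) = (if k = l then - D k else 0))"
  unfolding D_def using compat[unfolded compatible_def, THEN conjunct2] by (rule someI_ex)

lemma D_pos: "k \<in> {1..n} \<Longrightarrow> D k > 0"
  using D_prop by blast

lemma bilin_colv:
  assumes "l \<in> {1..n}"
  shows "bilin m L c (colv m B l) = - c l * D l"
proof -
  have "bilin m L c (colv m B l) = (\<Sum>k\<in>{1..m}. c k * (\<Sum>j\<in>{1..m}. L k j * B j l))"
    unfolding bilin_def colv_def by (simp add: sum_distrib_left mult.assoc)
  also have "\<dots> = (\<Sum>k\<in>{1..m}. if k = l then - c k * D k else 0)"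
  proof (intro sum.cong refl)
    fix k assume "k \<in> {1..m}"
    then have "(\<Sum>j\<in>{1..m}. L k j * B j l) = (if k = l then - D k else 0)"
      using D_prop assms by blast
    then show "c k * (\<Sum>j\<in>{1..m}. L k j * B j l) = (if k = l then - c k * D k else 0)"
      by simp
  qed
  also have "\<dots> = - c l * D l"
    using assms nm by (simp add: sum.delta)
  finally show ?thesis .
qed

text \<open>The form on the columns b_k and b_l can be evaluated through either argument; comparing
  the two values shows that D times B is skew-symmetric on [1,n].\<close>

lemma skew_symm: "k \<in> {1..n} \<Longrightarrow> l \<in> {1..n} \<Longrightarrow> B k l * D k = - B l k * D l"
  using bilin_colv[of l "colv m B k"] bilin_colv[of k "colv m B l"] skew[of "colv m B k" "colv m B l"] nm
  by (simp add: colv_def)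

lemma diag_zero: "k \<in> {1..n} \<Longrightarrow> B k k = 0"
  using skew_symm[of k k] D_pos[of k] by auto

lemma sign_opposite:
  assumes "k \<in> {1..n}" "l \<in> {1..n}"
  shows "t * B k l \<le> 0 \<longleftrightarrow> t * B l k \<ge> 0"
proof -
  have e: "(t * B k l) * D k = - ((t * B l k) * D l)"
    using skew_symm[OF assms] by (simp add: mult.assoc)
  have "t * B k l \<le> 0 \<longleftrightarrow> (t * B k l) * D k \<le> 0"
    using D_pos[OF assms(1)] by (simp add: mult_le_0_iff)
  also have "\<dots> \<longleftrightarrow> (t * B l k) * D l \<ge> 0"
    unfolding e by simp
  also have "\<dots> \<longleftrightarrow> t * B l k \<ge> 0"
    using D_pos[OF assms(2)] by (simp add: zero_le_mult_iff)
  finally show ?thesis .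
qed

lemma d_pos: "k \<in> {1..n} \<Longrightarrow> d k > 0"
  using dok by (simp add: d_ok_def)

lemma d_betav: "l \<in> {1..n} \<Longrightarrow> smul (int (d l)) (betav m d B l) = colv m B l"
  using dok by (simp add: d_ok_def betav_def colv_def fun_eq_iff vec_apply)

text \<open>This is D_l / d_l (\<open>d_Dt\<close>). Defined as a value of the form, it is an
  integer without any divisibility argument.\<close>

definition Dt :: "nat \<Rightarrow> int" where
  "Dt l = - bilin m L (unitv l) (betav m d B l)"

lemma d_Dt: "l \<in> {1..n} \<Longrightarrow> int (d l) * Dt l = D l"
  using bilin_colv[of l "unitv l"] by (simp add: d_betav[symmetric] bilin_linear Dt_def)

lemma Dt_pos: "l \<in> {1..n} \<Longrightarrow> Dt l > 0"
  using D_pos[of l] d_pos[of l] by (simp add: d_Dt[symmetric] zero_less_mult_iff)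

lemma bilin_betav:
  assumes "l \<in> {1..n}"
  shows "bilin m L c (betav m d B l) = - c l * Dt l"
proof -
  have "int (d l) * bilin m L c (betav m d B l) = int (d l) * (- c l * Dt l)"
    using bilin_colv[OF assms, of c] d_Dt[OF assms]
    by (simp add: d_betav[OF assms, symmetric] bilin_linear algebra_simps)
  moreover have "int (d l) \<noteq> 0"
    using d_pos[OF assms] by simp
  ultimately show ?thesis
    using mult_left_cancel by blast
qed

lemma bilin_betav_left: "l \<in> {1..n} \<Longrightarrow> bilin m L (betav m d B l) c = c l * Dt l"
  using skew[of "betav m d B l" c] by (simp add: bilin_betav)

lemma betav_diag: "k \<in> {1..n} \<Longrightarrow> betav m d B k k = 0"
  using diag_zero by (simp add: betav_def)

lemma colv_diag: "k \<in> {1..n} \<Longrightarrow> colv m B k k = 0"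
  using diag_zero by (simp add: colv_def)

lemma Evec_sign:
  assumes "i \<in> {1..n}"
  shows "Evec m 1 B i c = Evec m (- 1) B i c - smul (c i) (colv m B i)"
proof
  fix k
  show "Evec m 1 B i c k = (Evec m (- 1) B i c - smul (c i) (colv m B i)) k"
  proof (cases "k \<in> {1..m} \<and> k \<noteq> i")
    case True
    have "max (- B k i) 0 * c i = max (B k i) 0 * c i - B k i * c i"
      by (cases "B k i \<ge> 0") auto
    then show ?thesis using True by (simp add: Evec_def colv_def vec_apply)
  next
    case False
    then show ?thesis
      using colv_diag[OF assms] by (cases "k = i") (auto simp: Evec_def vec_apply colv_def)
  qed
qed

text \<open>By \<open>Evec_sign\<close> the images for the two signs differ by c_i b_i and e_i b_i;
  the two cross terms cancel, and b_i pairs to 0 with itself. With \<open>Evec_colv_sign\<close>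
  this makes the mutated pair independent of the sign.\<close>

lemma bilin_Evec_sign:
  assumes "i \<in> {1..n}"
  shows "bilin m L (Evec m 1 B i c) (Evec m 1 B i e) = bilin m L (Evec m (- 1) B i c) (Evec m (- 1) B i e)"
proof -
  have *: "bilin m L (colv m B i) x = x i * D i" for x
    using skew[of "colv m B i" x] bilin_colv[OF assms, of x] by simp
  show ?thesis
    unfolding Evec_sign[OF assms] by (simp add: bilin_linear bilin_colv[OF assms] * colv_diag[OF assms])
qed

lemma Evec_colv_sign:
  assumes "i \<in> {1..n}" "l \<in> {1..n}"
  shows "Evec m 1 B i (colv m B l + smul (max (B i l) 0) (colv m B i))
     = Evec m (- 1) B i (colv m B l + smul (max (- B i l) 0) (colv m B i))"
proof -
  have cl: "colv m B l i = B i l" using assms nm by (auto simp: colv_def)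
  have fix1: "Evec m t B i (smul r (colv m B i)) = smul r (colv m B i)" for r t
    using colv_diag[OF assms(1)] by (intro Evec_fix) (simp add: vec_apply)
  have "Evec m 1 B i (colv m B l + smul (max (B i l) 0) (colv m B i))
     = Evec m (- 1) B i (colv m B l) - smul (B i l) (colv m B i) + smul (max (B i l) 0) (colv m B i)"
    using Evec_sign[OF assms(1), of "colv m B l"] cl by (simp add: Evec_add fix1)
  also have "\<dots> = Evec m (- 1) B i (colv m B l) + smul (max (- B i l) 0) (colv m B i)"
    using max_pos_neg[of "B i l"] by (auto simp: fun_eq_iff vec_apply algebra_simps max_def)
  finally show ?thesis
    by (simp add: Evec_add fix1)
qed

lemma Evec_unit_betav:
  assumes "i \<in> {1..n}" "t \<in> {1, -1}" "k \<in> {1..m}" "k \<noteq> i"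
  shows "Evec m t B i (unitv i) k = int (d i) * max (- t * betav m d B i k) 0"
proof -
  have "B k i = int (d i) * betav m d B i k"
    using fun_cong[OF d_betav[OF assms(1)], of k] assms(3) by (simp add: colv_def vec_apply)
  then have "- t * B k i = int (d i) * (- t * betav m d B i k)"
    by simp
  then have "max (- t * B k i) 0 = int (d i) * max (- t * betav m d B i k) 0"
    using d_pos[OF assms(1)]
    by (auto simp: max_def mult_le_0_iff zero_le_mult_iff not_le zero_less_mult_iff mult_less_0_iff)
  then show ?thesis using assms by (simp add: Evec_def)
qed

text \<open>The exponents of the exchange polynomial are equally spaced on a line in direction
  beta_i. Its two ends are the vectors E e_i for the two signs; \<open>mut_vec_neg\<close> counts
  from the other end.\<close>

lemma mut_vec_pos:
  assumes "i \<in> {1..n}" "r \<le> d i"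
  shows "mut_vec m d B i r = Evec m 1 B i (unitv i) + smul (int r) (betav m d B i)"
proof
  fix k
  consider "k \<notin> {1..m}" | "k = i" | "k \<in> {1..m}" "k \<noteq> i" by blast
  then show "mut_vec m d B i r k = (Evec m 1 B i (unitv i) + smul (int r) (betav m d B i)) k"
  proof cases
    case 1
    have "zvec m (Evec m 1 B i (unitv i) + smul (int r) (betav m d B i))"
      using assms nm by auto
    then show ?thesis using 1 by (auto simp: mut_vec_def zvec_def)
  next
    case 2
    then show ?thesis using assms nm diag_zero[OF assms(1)] betav_diag[OF assms(1)]
      by (simp add: mut_vec_def vec_apply)
  next
    case 3
    define b where "b = B k i div int (d i)"
    have "int r * max b 0 + int (d i - r) * max (- b) 0 = int (d i) * max (- b) 0 + int r * b"
      using assms(2) by (auto simp: max_def of_nat_diff algebra_simps)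
    then show ?thesis
      using 3 Evec_unit_betav[OF assms(1) _ 3, of 1] by (simp add: mut_vec_def vec_apply betav_def b_def)
  qed
qed

lemma mut_vec_neg:
  assumes "i \<in> {1..n}" "r \<le> d i"
  shows "mut_vec m d B i r = Evec m (- 1) B i (unitv i) - smul (int (d i - r)) (betav m d B i)"
proof -
  have "Evec m 1 B i (unitv i) = Evec m (- 1) B i (unitv i) - smul (int (d i)) (betav m d B i)"
    using Evec_sign[OF assms(1), of "unitv i"] d_betav[OF assms(1)] by simp
  then show ?thesis
    unfolding mut_vec_pos[OF assms] using assms(2)
    by (simp add: of_nat_diff fun_eq_iff vec_apply algebra_simps)
qed

end

section \<open>Seeds with independent monomials and their exchange polynomials\<close>

context central_unit
begin

text \<open>Powers of \<open>v\<close> as an operator, so that the simplifier can collect them without looping.\<close>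

definition vs :: "int \<Rightarrow> 'f \<Rightarrow> 'f" where
  "vs k y = v powi k * y"

lemma vp_simps:
  "v powi k * y = vs k y" "y * v powi k = vs k y"
  "x * vs k y = vs k (x * y)" "vs k x * y = vs k (x * y)" "vs k (vs l y) = vs (k + l) y"
  by (simp_all add: vs_def vp_add mult.assoc) (metis vp_comm mult.assoc)+

lemma vs_0 [simp]: "vs 0 y = y"
  by (simp add: vs_def)

lemma qcomm_powi:
  assumes "P * Q = v powi s * (Q * P)" "P \<noteq> 0"
  shows "P powi k * Q = v powi (k * s) * (Q * P powi k)"
proof -
  have nat: "P ^ l * Q = v powi (int l * s) * (Q * P ^ l)" for l
  proof (induction l)
    case (Suc l)
    have "P ^ Suc l * Q = P * (P ^ l * Q)" by (simp add: mult.assoc)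
    also have "\<dots> = v powi (int l * s) * ((P * Q) * P ^ l)"
      unfolding Suc by (simp add: vp_simps mult.assoc)
    also have "\<dots> = v powi (int (Suc l) * s) * (Q * P ^ Suc l)"
      unfolding assms(1) by (simp add: vp_simps mult.assoc algebra_simps)
    finally show ?case .
  qed simp
  show ?thesis
  proof (cases "k \<ge> 0")
    case True
    then show ?thesis using nat[of "nat k"] by (simp add: power_int_def)
  next
    case False
    define l where "l = nat (- k)"
    then have l: "k = - int l" using False by simp
    have Pl: "P ^ l \<noteq> 0" using assms(2) by simp
    have "P ^ l * (v powi (- int l * s) * (Q * inverse (P ^ l))) = v powi (- int l * s) * ((P ^ l * Q) * inverse (P ^ l))"
      by (simp add: vp_simps mult.assoc)
    also have "\<dots> = Q"
      unfolding nat using Pl by (simp add: vp_simps mult.assoc)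
    finally have "inverse (P ^ l) * Q = v powi (- int l * s) * (Q * inverse (P ^ l))"
      using Pl by (metis left_inverse mult.assoc mult_1_left)
    then show ?thesis
      unfolding l by (simp add: power_int_minus)
  qed
qed

end

text \<open>Independence of the monomials is the form in which the fraction field hypothesis enters.
  It passes to mutated seeds (\<open>seed1\<close>), so the locale is available at every
  mutation-equivalent seed.\<close>

locale indep_seed = central_unit m v + compat_pair m n d L B
  for m :: nat and v :: "'f::division_ring" and n d L B +
  fixes X :: "(nat \<Rightarrow> int) \<Rightarrow> 'f" and h :: "nat \<Rightarrow> nat \<Rightarrow> 'f"
  assumes hok: "h_ok n d v h" and q: "qrule m v L X" and ind: "indep X"
begin

lemma X_nz: "zvec m c \<Longrightarrow> X c \<noteq> 0"
  using indep_nz[OF ind] .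

lemma X_0 [simp]: "X 0 = 1"
  by (intro qrule_zero[OF q] X_nz zvec_0)

lemma skewL: "\<forall>k\<in>{1..m}. \<forall>l\<in>{1..m}. L k l = - L l k"
  using compat unfolding compatible_def by blast

lemma Lring_seed: "Lring m v (clvar (X, h, L, B)) = Sp X UNIV"
  by (rule Lring_eq_Sp[OF q X_nz skewL]) (auto simp: clvar_def)

lemma X_comm: "zvec m a \<Longrightarrow> zvec m b \<Longrightarrow> X a * X b = v powi (2 * bilin m L a b) * (X b * X a)"
  using qruleD[OF q, of a b] qruleD[OF q, of b a] skew[of b a]
  by (simp add: vp_simps add.commute)

lemma in_m: "i \<in> {1..n} \<Longrightarrow> i \<in> {1..m}"
  using nm by auto

lemma h_Zq: "i \<in> {1..n} \<Longrightarrow> r \<le> d i \<Longrightarrow> h i r \<in> Zq v"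
  using hok unfolding h_ok_def by blast

lemma h_0: "i \<in> {1..n} \<Longrightarrow> h i 0 = 1"
  using hok unfolding h_ok_def by blast

lemma h_sym: "i \<in> {1..n} \<Longrightarrow> r \<le> d i \<Longrightarrow> h i (d i - r) = h i r"
  using hok[unfolded h_ok_def, THEN bspec, of i] by (metis (no_types))

abbreviation mv :: "nat \<Rightarrow> 'f" where
  "mv i \<equiv> mut_var m d (X, h, L, B) i"

abbreviation bet :: "nat \<Rightarrow> nat \<Rightarrow> int" where
  "bet \<equiv> betav m d B"

abbreviation Ev :: "int \<Rightarrow> nat \<Rightarrow> (nat \<Rightarrow> int) \<Rightarrow> nat \<Rightarrow> int" where
  "Ev t i \<equiv> Evec m t B i"

text \<open>The symmetry h_{i,r} = h_{i,d_i-r} lets the polynomial be read from either end of its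
  line of exponents, so the sign t can be chosen freely later.\<close>

lemma mut_var_form:
  assumes i: "i \<in> {1..n}" and "t \<in> {1, -1}"
  shows "mv i = (\<Sum>r\<in>{0..d i}. h i r * X (Ev t i (unitv i) + smul (int r * t) (bet i)))"
proof (cases "t = 1")
  case True
  then show ?thesis unfolding mut_var_def by (simp add: mut_vec_pos[OF i])
next
  case False
  then have t: "t = - 1" using assms by auto
  have "mv i = (\<Sum>r\<in>{0..d i}. h i r * X (Ev (- 1) i (unitv i) - smul (int (d i - r)) (bet i)))"
    unfolding mut_var_def by (simp add: mut_vec_neg[OF i])
  also have "\<dots> = (\<Sum>r\<in>{0..d i}. h i (d i - r) * X (Ev (- 1) i (unitv i) - smul (int r) (bet i)))"
    by (rule sum.reindex_bij_witness[of _ "\<lambda>r. d i - r" "\<lambda>r. d i - r"]) auto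
  also have "\<dots> = (\<Sum>r\<in>{0..d i}. h i r * X (Ev t i (unitv i) + smul (int r * t) (bet i)))"
  proof (intro sum.cong refl)
    fix r assume "r \<in> {0..d i}"
    moreover have "Ev (- 1) i (unitv i) - smul (int r) (bet i)
        = Ev t i (unitv i) + smul (int r * t) (bet i)"
      by (simp add: t fun_eq_iff vec_apply)
    ultimately show "h i (d i - r) * X (Ev (- 1) i (unitv i) - smul (int r) (bet i))
        = h i r * X (Ev t i (unitv i) + smul (int r * t) (bet i))"
      using h_sym[OF i] by simp
  qed
  finally show ?thesis .
qed

text \<open>The end monomial has coefficient h_{i,0} = 1, which is why lowest terms in the mutated
  seed are plain monomials.\<close>

lemma mut_var_lead:
  assumes i: "i \<in> {1..n}" and t: "t \<in> {1, -1}"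
  shows "mv i - X (Ev t i (unitv i))
     \<in> Sp X {Ev t i (unitv i) + smul (s * t) (bet i) |s. s \<ge> 1}"
proof -
  have "mv i = h i 0 * X (Ev t i (unitv i) + smul (int 0 * t) (bet i))
     + (\<Sum>r\<in>{0..d i}-{0}. h i r * X (Ev t i (unitv i) + smul (int r * t) (bet i)))"
    unfolding mut_var_form[OF assms] by (subst sum.remove[of _ 0]) auto
  then have "mv i - X (Ev t i (unitv i))
      = (\<Sum>r\<in>{0..d i}-{0}. h i r * X (Ev t i (unitv i) + smul (int r * t) (bet i)))"
    using h_0[OF i] by simp
  also have "\<dots> \<in> Sp X {Ev t i (unitv i) + smul (s * t) (bet i) |s. s \<ge> 1}"
    using h_Zq[OF i] in_m[OF i]
    by (intro Sp_sum Sp_monom) (auto intro!: exI[of _ "int r" for r])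
  finally show ?thesis .
qed

lemma mut_var_nz:
  assumes i: "i \<in> {1..n}"
  shows "mv i \<noteq> 0"
proof
  assume 0: "mv i = 0"
  let ?u = "Ev 1 i (unitv i)"
  have u: "zvec m ?u" using in_m[OF i] by simp
  have "- (mv i - X ?u) \<in> Sp X {?u + smul (s * 1) (bet i) |s. s \<ge> 1}"
    using mut_var_lead[OF i, of 1] by (intro Sp_uminus) auto
  then have "X ?u \<in> Sp X {?u + smul (s * 1) (bet i) |s. s \<ge> 1}"
    using 0 by simp
  moreover have "X ?u \<in> Sp X {?u}"
    using u by (intro Sp_X) auto
  moreover have "{?u + smul (s * 1) (bet i) |s. s \<ge> 1} \<inter> {?u} = {}"
  proof -
    have False if "?u + smul (s * 1) (bet i) = ?u" "s \<ge> 1" for s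
    proof -
      \<comment> \<open>Pairing with e_i separates the points of the line, since beta_i has the
        nonzero value \<open>- Dt i\<close> there.\<close>
      have "bilin m L (unitv i) (?u + smul (s * 1) (bet i)) = bilin m L (unitv i) ?u"
        using that by simp
      then show False
        using that Dt_pos[OF i] by (simp add: bilin_linear bilin_betav[OF i])
    qed
    then show ?thesis by auto
  qed
  ultimately show False
    using Sp_disjoint[OF ind] X_nz[OF u] by blast
qed

text \<open>A vector with e_i = 0 pairs to 0 with beta_i, so all monomials of the exchange
  polynomial commute with \<open>X e\<close> up to the same power of v.\<close>

lemma mut_var_comm:
  assumes i: "i \<in> {1..n}" and t: "t \<in> {1, -1}" and e: "zvec m e" "e i = 0"
  shows "mv i * X e = v powi (2 * bilin m L (Ev t i (unitv i)) e) * (X e * mv i)"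
proof -
  have *: "h i r * X (Ev t i (unitv i) + smul (int r * t) (bet i)) * X e
     = v powi (2 * bilin m L (Ev t i (unitv i)) e)
        * (X e * (h i r * X (Ev t i (unitv i) + smul (int r * t) (bet i))))" if "r \<le> d i" for r
  proof -
    let ?w = "Ev t i (unitv i) + smul (int r * t) (bet i)"
    have "X ?w * X e = v powi (2 * bilin m L (Ev t i (unitv i)) e) * (X e * X ?w)"
      using X_comm[of ?w e] e in_m[OF i] by (simp add: bilin_linear bilin_betav_left[OF i])
    then have "h i r * X ?w * X e = h i r * (v powi (2 * bilin m L (Ev t i (unitv i)) e) * (X e * X ?w))"
      by (simp add: mult.assoc)
    also have "\<dots> = v powi (2 * bilin m L (Ev t i (unitv i)) e) * (h i r * X e * X ?w)"
      by (simp add: vp_simps mult.assoc)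
    also have "h i r * X e = X e * h i r"
      by (rule Zq_comm[OF h_Zq[OF i that]])
    finally show ?thesis by (simp add: mult.assoc)
  qed
  show ?thesis
    unfolding mut_var_form[OF i t] sum_distrib_left sum_distrib_right
    using * by (intro sum.cong) auto
qed

text \<open>\<open>is_mutation\<close> is a predicate on maps, so the seeds mu_j X and mu_j (mu_i X)
  of the argument have to be constructed.\<close>

lemma mutation_exists:
  assumes i: "i \<in> {1..n}" and t: "t \<in> {1, -1}"
  shows "\<exists>X1. is_mutation m n d v t i (X, h, L, B) (X1, h, mut_Lambda m t i L B, mut_B m n t i B)"
proof -
  have im: "i \<in> {1..m}" using in_m[OF i] .
  define u where "u = Ev t i (unitv i)"
  define z where "z c = c - smul (c i) (unitv i)" for c :: "nat \<Rightarrow> int"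
  \<comment> \<open>Here E c = \<open>z c\<close> + c_i \<open>u\<close>. The map is the ordered
    product of X at \<open>z c\<close> and the power c_i of the new variable; the power of v is the
    factor by which the product of monomials at \<open>z c\<close> and c_i \<open>u\<close> differs
    from the monomial at E c.\<close>
  define X1 where "X1 c = v powi (- (c i * bilin m L (z c) u)) * (X (z c) * mv i powi c i)" for c
  have z_i: "z c i = 0" for c by (simp add: z_def vec_apply)
  have z_zv: "zvec m (z c)" if "zvec m c" for c using that im by (simp add: z_def)
  have z_add: "z (c + e) = z c + z e" for c e by (simp add: z_def fun_eq_iff vec_apply algebra_simps)
  have Ez: "Ev t i c = z c + smul (c i) u" for c
  proof -
    have "Ev t i c = Ev t i (z c + smul (c i) (unitv i))" by (simp add: z_def)
    also have "\<dots> = z c + smul (c i) u"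
      using z_i[of c] by (simp add: Evec_add Evec_smul Evec_fix u_def)
    finally show ?thesis .
  qed
  have comm: "mv i powi k * X (z e) = v powi (k * (2 * bilin m L u (z e))) * (X (z e) * mv i powi k)"
    if "zvec m e" for k e
    using mut_var_comm[OF i t z_zv[OF that] z_i] mut_var_nz[OF i] unfolding u_def
    by (intro qcomm_powi) auto
  have "X1 c * X1 e = v powi bilin m (mut_Lambda m t i L B) c e * X1 (c + e)"
    if ce: "zvec m c" "zvec m e" for c e
  proof -
    have "X1 c * X1 e = v powi (- (c i * bilin m L (z c) u) - e i * bilin m L (z e) u)
        * (X (z c) * (mv i powi c i * X (z e)) * mv i powi e i)"
      unfolding X1_def by (simp add: vp_simps mult.assoc diff_diff_eq add.commute)
    also have "\<dots> = v powi (- (c i * bilin m L (z c) u) - e i * bilin m L (z e) u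
        + c i * (2 * bilin m L u (z e))) * ((X (z c) * X (z e)) * (mv i powi c i * mv i powi e i))"
      unfolding comm[OF ce(2)] by (simp add: vp_simps algebra_simps)
    also have "\<dots> = v powi (- (c i * bilin m L (z c) u) - e i * bilin m L (z e) u
        + c i * (2 * bilin m L u (z e)) + bilin m L (z c) (z e)) * (X (z c + z e) * mv i powi (c i + e i))"
      using mut_var_nz[OF i] qruleD[OF q z_zv[OF ce(1)] z_zv[OF ce(2)]]
      by (simp add: vp_simps mult.assoc[symmetric] power_int_add) (simp add: vp_simps algebra_simps)
    also have "\<dots> = v powi bilin m (mut_Lambda m t i L B) c e * X1 (c + e)"
      unfolding X1_def bilin_mut_Lambda[OF im] Ez z_add
      using skew[of "z e" u] by (simp add: vp_simps bilin_linear algebra_simps vec_apply)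
    finally show ?thesis .
  qed
  then have "qrule m v (mut_Lambda m t i L B) X1"
    unfolding qrule_def plus_fun_def by blast
  moreover have "X1 (unitv k) = X (unitv k)" if "k \<noteq> i" for k
  proof -
    have "unitv k i = 0" using that by (auto simp: unitv_def)
    then show ?thesis by (simp add: X1_def z_def)
  qed
  moreover have "X1 (unitv i) = mv i"
    by (simp add: X1_def z_def)
  ultimately show ?thesis
    unfolding is_mutation_def by auto
qed

end

text \<open>Both signs give the same mutation, and the matrices of a mutated seed matter only
  within range; the following assumptions are therefore symmetric in the two seeds.\<close>

locale mutated = indep_seed m v n d L B X h
  for m :: nat and v :: "'f::division_ring" and n d L B X h +
  fixes i :: nat and L1 B1 :: "nat \<Rightarrow> nat \<Rightarrow> int" and X1 :: "(nat \<Rightarrow> int) \<Rightarrow> 'f"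
  assumes i: "i \<in> {1..n}"
    and bil: "t \<in> {1, -1} \<Longrightarrow> bilin m L1 c e = bilin m L (Evec m t B i c) (Evec m t B i e)"
    and col_i: "colv m B1 i = - colv m B i"
    and col_l: "l \<in> {1..n} \<Longrightarrow> l \<noteq> i \<Longrightarrow> t \<in> {1, -1} \<Longrightarrow>
        colv m B1 l = Evec m t B i (colv m B l + smul (max (t * B i l) 0) (colv m B i))"
    and q1: "qrule m v L1 X1"
    and X1_unit: "k \<in> {1..m} \<Longrightarrow> k \<noteq> i \<Longrightarrow> X1 (unitv k) = X (unitv k)"
    and X1_i: "X1 (unitv i) = mut_var m d (X, h, L, B) i"

lemma (in indep_seed) is_mutation_mutated:
  assumes "i \<in> {1..n}" "t \<in> {1, -1}" and mut: "is_mutation m n d v t i (X, h, L, B) (X1, h1, L1, B1)"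
  shows "mutated m v n d L B X h i L1 B1 X1"
proof
  note ii = assms(1) in_m[OF assms(1)]
  have L1: "L1 = mut_Lambda m t i L B" and B1: "B1 = mut_B m n t i B"
    and "qrule m v L1 X1" using mut unfolding is_mutation_def by auto
  show "i \<in> {1..n}" "qrule m v L1 X1" by fact+
  show "X1 (unitv k) = X (unitv k)" if "k \<in> {1..m}" "k \<noteq> i" for k
    using mut that unfolding is_mutation_def by auto
  show "X1 (unitv i) = mv i"
    using mut unfolding is_mutation_def by auto
  show "bilin m L1 c e = bilin m L (Ev s i c) (Ev s i e)" if "s \<in> {1, -1}" for s c e
    using that assms(2) bilin_mut_Lambda[OF ii(2)] bilin_Evec_sign[OF ii(1)] unfolding L1 by auto
  show "colv m B1 i = - colv m B i"
    unfolding B1 colv_mut_B[OF ii(1) nm ii(1)] using colv_diag[OF ii(1)]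
    by (simp add: Evec_uminus Evec_fix)
  show "colv m B1 l = Ev s i (colv m B l + smul (max (s * B i l) 0) (colv m B i))"
    if "l \<in> {1..n}" "l \<noteq> i" "s \<in> {1, -1}" for s l
    using that assms(2) colv_mut_B[OF ii(1) nm that(1)] Evec_colv_sign[OF ii(1) that(1)] unfolding B1 by auto
qed

section \<open>Monomials of the mutated seed and their lowest terms\<close>

context mutated
begin

lemma i_m: "i \<in> {1..m}"
  using in_m[OF i] .

lemma i_z [simp]: "zvec m (unitv i)"
  using i_m by simp

lemma X1_0nz: "X1 0 \<noteq> 0"
  using qruleD[OF q1, of 0 "unitv i"] mut_var_nz[OF i] X1_i by auto

lemma X1_0 [simp]: "X1 0 = 1"
  using qrule_zero[OF q1 X1_0nz] .

lemma X1_nz: "zvec m c \<Longrightarrow> X1 c \<noteq> 0"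
  using qrule_nz[OF q1 X1_0nz] .

lemma bil_off: "c i = 0 \<Longrightarrow> e i = 0 \<Longrightarrow> bilin m L1 c e = bilin m L c e"
  using bil[of 1 c e] by (simp add: Evec_fix)

lemma X1_off:
  assumes "zvec m c" "c i = 0"
  shows "X1 c = X c"
proof -
  have "c i = 0 \<longrightarrow> X1 c = X c"
    using assms(1)
  proof (induction rule: zvec_induct)
    case zero
    then show ?case by simp
  next
    case (plus c k)
    show ?case
    proof
      assume 0: "(c + unitv k) i = 0"
      then have k: "k \<noteq> i" using plus(3) by (auto simp: vec_apply)
      then have ui: "unitv k i = 0" by (auto simp: unitv_def)
      then have ci: "c i = 0" using 0 by (simp add: vec_apply)
      show "X1 (c + unitv k) = X (c + unitv k)"
        using qrule_add[OF q1, of c "unitv k"] qrule_add[OF q, of c "unitv k"] plus X1_unit[OF plus(1) k] ci ui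
        by (simp add: bil_off)
    qed
  next
    case (minus c k)
    show ?case
    proof
      assume 0: "(c - unitv k) i = 0"
      then have k: "k \<noteq> i" using minus(3) by (auto simp: vec_apply)
      then have ui: "unitv k i = 0" by (auto simp: unitv_def)
      then have ci: "c i = 0" using 0 by (simp add: vec_apply)
      have uz: "zvec m (unitv k)" using minus(1) by simp
      have "bilin m L1 (unitv k) (unitv k) = 0"
        using bil_off[of "unitv k" "unitv k"] ui by simp
      then have "X1 (- unitv k) = X (- unitv k)"
        using qrule_uminus[OF q1 X1_0nz uz] qrule_uminus[OF q X_nz uz] X1_unit[OF minus(1) k] by simp
      then have "X1 (c + - unitv k) = X (c + - unitv k)"
        using qrule_add[OF q1, of c "- unitv k"] qrule_add[OF q, of c "- unitv k"] minus ci ui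
        by (simp add: bil_off vec_apply)
      then show "X1 (c - unitv k) = X (c - unitv k)" by simp
    qed
  qed
  then show ?thesis using assms(2) by blast
qed

text \<open>Induction on c_i, splitting off one factor \<open>X1 (unitv i)\<close> and writing A B -
  A0 B0 as (A - A0) B + A0 (B - B0). The restriction to c_i >= 0 matters: the inverse of an exchange
  polynomial is in general not a finite sum of monomials.\<close>

lemma X1_lead:
  assumes t: "t \<in> {1, -1}" and "zvec m c" "c i \<ge> 0"
  shows "X1 c - X (Ev t i c) \<in> Sp X {Ev t i c + smul (s * t) (bet i) |s. s \<ge> 1}"
  using assms(2,3)
proof (induction "nat (c i)" arbitrary: c)
  case 0
  then have "c i = 0" by simp
  then show ?case using X1_off[of c] 0 by (simp add: Evec_fix Sp.zero)
next
  case (Suc k)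
  define c' where "c' = c - unitv i"
  let ?u = "Ev t i (unitv i)" and ?w = "Ev t i c'"
  let ?U = "\<lambda>c a. {Ev t i c + smul (s * t) (bet i) |s. s \<ge> a}"
  have c: "c = c' + unitv i" by (simp add: c'_def)
  have z: "zvec m c'" "zvec m ?w" "zvec m ?u" using Suc by (simp_all add: c'_def)
  have hi: "X1 c' - X ?w \<in> Sp X (?U c' 1)"
    using Suc z by (intro Suc.hyps) (auto simp: c'_def vec_apply)
  have ui1: "X1 (unitv i) - X ?u \<in> Sp X (?U (unitv i) 1)"
    using mut_var_lead[OF i t] by (simp add: X1_i)
  have uu: "X ?u \<in> Sp X (?U (unitv i) 0)"
    using z by (intro Sp_X) (auto intro!: exI[of _ "0::int"])
  have ui0: "X1 (unitv i) \<in> Sp X (?U (unitv i) 0)"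
    using Sp_add[OF Sp_mono[OF ui1, of "?U (unitv i) 0"] uu] by fastforce
  have ww: "X ?w \<in> Sp X {?w}"
    using z by (intro Sp_X) auto
  have "(X1 c' - X ?w) * X1 (unitv i) \<in> Sp X (?U c 1)"
  proof (rule Sp_mult[OF q hi ui0])
    fix a b assume "a \<in> ?U c' 1" "b \<in> ?U (unitv i) 0"
    then obtain r s where "a = ?w + smul (r * t) (bet i)" "b = ?u + smul (s * t) (bet i)" "r \<ge> 1" "s \<ge> 0"
      by blast
    then have "a + b = Ev t i c + smul ((r + s) * t) (bet i)" "r + s \<ge> 1"
      unfolding c by (auto simp: Evec_add fun_eq_iff vec_apply algebra_simps)
    then show "a + b \<in> ?U c 1" by blast
  qed
  moreover have "X ?w * (X1 (unitv i) - X ?u) \<in> Sp X (?U c 1)"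
  proof (rule Sp_mult[OF q ww ui1])
    fix a b assume "a \<in> {?w}" "b \<in> ?U (unitv i) 1"
    then obtain s where "a = ?w" "b = ?u + smul (s * t) (bet i)" "s \<ge> 1"
      by blast
    then have "a + b = Ev t i c + smul (s * t) (bet i)" "s \<ge> 1"
      unfolding c by (auto simp: Evec_add fun_eq_iff vec_apply algebra_simps)
    then show "a + b \<in> ?U c 1" by blast
  qed
  ultimately have "(X1 c' - X ?w) * X1 (unitv i) + X ?w * (X1 (unitv i) - X ?u) \<in> Sp X (?U c 1)"
    by (rule Sp_add)
  moreover have "X1 c - X (Ev t i c) = v powi (- bilin m L1 c' (unitv i))
      * ((X1 c' - X ?w) * X1 (unitv i) + X ?w * (X1 (unitv i) - X ?u))"
    unfolding c using qrule_add[OF q1 z(1) i_z] qrule_add[OF q z(2,3)] bil[OF t, of c' "unitv i"]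
    by (simp add: Evec_add right_diff_distrib left_diff_distrib)
  ultimately show ?case
    using Sp_scale[of _ X "?U c 1"] by simp
qed

end

section \<open>Gradings by linear forms\<close>

locale lin_form =
  fixes f :: "(nat \<Rightarrow> int) \<Rightarrow> int"
  assumes add: "f (a + b) = f a + f b" and smul: "f (smul r a) = r * f a"
begin

lemma uminus: "f (- a) = - f a"
  using smul[of "- 1" a] by simp

lemma diff: "f (a - b) = f a - f b"
  using add[of a "- b"] uminus[of b] by simp

lemma zero [simp]: "f 0 = 0"
  using smul[of 0 0] by simp

lemmas lin = add smul uminus diff

end

lemma lin_form_coord: "lin_form (\<lambda>c. c j)"
  by standard (simp_all add: vec_apply)

lemma lin_form_bilin: "lin_form (\<lambda>c. r * bilin m L e c)"
  by standard (simp_all add: bilin_linear algebra_simps)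

context mutated
begin

text \<open>Along the line of \<open>X1_lead\<close> the degree changes by s t f(beta_i). The sign
  of this number decides between a single lowest monomial here, a lower bound in
  \<open>X1_ge_form\<close> and homogeneity in \<open>X1_homogeneous\<close>.\<close>

lemma X1_lead_form:
  assumes "lin_form f" and t: "t \<in> {1, -1}" and "t * f (bet i) > 0" and c: "zvec m c" "c i \<ge> 0"
  shows "X1 c - X (Ev t i c) \<in> Sp X {e. f e > f (Ev t i c)}"
proof -
  interpret f: lin_form f by fact
  show ?thesis
  proof (rule Sp_mono[OF X1_lead[OF t c]])
    fix e assume "e \<in> {Ev t i c + smul (s * t) (bet i) |s. s \<ge> 1}"
    then obtain s where s: "e = Ev t i c + smul (s * t) (bet i)" "s \<ge> 1" by blast
    have "s * (t * f (bet i)) > 0" using s(2) assms(3) by simp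
    then show "e \<in> {e. f e > f (Ev t i c)}" unfolding s by (simp add: f.lin mult.assoc)
  qed
qed

lemma X1_ge_form:
  assumes "lin_form f" and t: "t \<in> {1, -1}" and ge: "t * f (bet i) \<ge> 0" and c: "zvec m c" "c i \<ge> 0"
  shows "X1 c \<in> Sp X {e. f e \<ge> f (Ev t i c)}"
proof -
  interpret f: lin_form f by fact
  have "X1 c - X (Ev t i c) \<in> Sp X {e. f e \<ge> f (Ev t i c)}"
  proof (rule Sp_mono[OF X1_lead[OF t c]])
    fix e assume "e \<in> {Ev t i c + smul (s * t) (bet i) |s. s \<ge> 1}"
    then obtain s where s: "e = Ev t i c + smul (s * t) (bet i)" "s \<ge> 1" by blast
    have "s * (t * f (bet i)) \<ge> 0" using s(2) ge by simp
    then show "e \<in> {e. f e \<ge> f (Ev t i c)}" unfolding s by (simp add: f.lin mult.assoc)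
  qed
  moreover have "X (Ev t i c) \<in> Sp X {e. f e \<ge> f (Ev t i c)}"
    using c by (intro Sp_X) auto
  ultimately show ?thesis using Sp_add by fastforce
qed

lemma X1_homogeneous:
  assumes "lin_form f" and t: "t \<in> {1, -1}" and "f (bet i) = 0" and c: "zvec m c" "c i \<ge> 0"
  shows "X1 c \<in> Sp X {e. f e = f (Ev t i c)}"
proof -
  interpret f: lin_form f by fact
  have "X1 c - X (Ev t i c) \<in> Sp X {e. f e = f (Ev t i c)}"
    by (rule Sp_mono[OF X1_lead[OF t c]]) (auto simp: f.lin assms(3))
  moreover have "X (Ev t i c) \<in> Sp X {e. f e = f (Ev t i c)}"
    using c by (intro Sp_X) auto
  ultimately show ?thesis using Sp_add by fastforce
qed

lemma X1_coord:
  assumes "zvec m c" "c i \<ge> 0"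
  shows "X1 c \<in> Sp X {e. e i = - c i}"
  using X1_homogeneous[OF lin_form_coord[of i], of 1, OF _ _ assms] betav_diag[OF i] by simp

text \<open>E is an involution, so the lowest terms \<open>X (Ev t i c)\<close> for different c are
  different monomials and cannot cancel.\<close>

lemma lead_zero:
  assumes "lin_form f" and t: "t \<in> {1, -1}" and pos: "t * f (bet i) > 0"
    and C: "finite C" "\<And>c. c \<in> C \<Longrightarrow> zvec m c \<and> c i \<ge> 0 \<and> f (Ev t i c) = k"
    and a: "\<And>c. c \<in> C \<Longrightarrow> a c \<in> Zq v"
    and hi: "(\<Sum>c\<in>C. a c * X1 c) \<in> Sp X {e. f e > k}"
    and c: "c \<in> C"
  shows "a c = 0"
proof -
  let ?s = "\<Sum>c\<in>C. a c * X (Ev t i c)"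
  have "(\<Sum>c\<in>C. a c * (X1 c - X (Ev t i c))) \<in> Sp X {e. f e > k}"
  proof (intro Sp_sum Sp_scale)
    fix c assume "c \<in> C"
    then show "X1 c - X (Ev t i c) \<in> Sp X {e. f e > k}" "a c \<in> Zq v"
      using X1_lead_form[OF assms(1-3), of c] C(2)[of c] a by auto
  qed
  then have "(\<Sum>c\<in>C. a c * X1 c) - (\<Sum>c\<in>C. a c * (X1 c - X (Ev t i c))) \<in> Sp X {e. f e > k}"
    using hi by (rule Sp_diff[rotated])
  then have "?s \<in> Sp X {e. f e > k}"
    by (simp add: right_diff_distrib sum_subtractf)
  moreover have "?s \<in> Sp X {e. f e = k}"
    using C a by (intro Sp_sum Sp_monom) auto
  ultimately have "?s = 0"
    by (rule Sp_disjoint[OF ind]) auto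
  moreover have "inj_on (Ev t i) C"
    by (rule inj_onI) (metis Evec_Evec)
  then have "?s = (\<Sum>e\<in>Ev t i ` C. a (Ev t i e) * X e)"
    by (simp add: sum.reindex)
  ultimately have "a (Ev t i (Ev t i c)) = 0"
    using C a c by (intro indepD[OF ind, of "Ev t i ` C" "\<lambda>e. a (Ev t i e)"]) auto
  then show ?thesis by simp
qed

lemma lead_inj:
  assumes "lin_form f" and t: "t \<in> {1, -1}" and pos: "t * f (bet i) > 0"
    and y: "y \<in> Sp X1 {c. c i \<ge> 0 \<and> f (Ev t i c) = k}" "y \<in> Sp X {e. f e > k}"
  shows "y = 0"
proof -
  obtain C a where C: "finite C" "C \<subseteq> {c. c i \<ge> 0 \<and> f (Ev t i c) = k}" "\<forall>c\<in>C. zvec m c"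
     "\<forall>c. a c \<in> Zq v" "y = (\<Sum>c\<in>C. a c * X1 c)" using Sp_repr[OF y(1)] by blast
  have "a c = 0" if "c \<in> C" for c
    using C y(2) by (intro lead_zero[OF assms(1-3) C(1) _ _ _ that, of k]) auto
  then show ?thesis using C(5) by simp
qed

text \<open>A relation is multiplied by a power of \<open>X1 (unitv i)\<close> that makes all
  exponents at i nonnegative; its part of lowest degree then contradicts
  \<open>lead_zero\<close>.\<close>

lemma indep1: "indep X1"
  unfolding indep_def
proof (intro allI impI ballI, rule ccontr)
  fix C a c
  assume C: "finite C" "\<forall>c\<in>C. zvec m c" "\<forall>c\<in>C. a c \<in> Zq v" "(\<Sum>c\<in>C. a c * X1 c) = 0"
    and c: "c \<in> C" "a c \<noteq> 0"
  \<comment> \<open>The form is chosen to take the positive value \<open>Dt i\<close> on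
    beta_i.\<close>
  define f where "f = (\<lambda>c. - 1 * bilin m L (unitv i) c)"
  interpret f: lin_form f unfolding f_def by (rule lin_form_bilin)
  have pos: "1 * f (bet i) > 0"
    using Dt_pos[OF i] by (simp add: f_def bilin_betav[OF i])
  define g where "g c = f (Ev 1 i c)" for c
  define C' where "C' = {c\<in>C. a c \<noteq> 0}"
  define k where "k = Min (g ` C')"
  define C0 where "C0 = {c\<in>C'. g c = k}"
  have fin: "finite C'" "finite C0" and ne: "C' \<noteq> {}"
    using C c by (auto simp: C'_def C0_def)
  have "k \<in> g ` C'" unfolding k_def using fin ne by (intro Min_in) auto
  then obtain c0 where c0: "c0 \<in> C0" by (auto simp: C0_def)
  have kmin: "g c \<ge> k" if "c \<in> C'" for c
    unfolding k_def using that fin by auto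
  \<comment> \<open>A crude common bound for the absolute values of all c_i.\<close>
  define p where "p = (\<Sum>c\<in>C'. \<bar>c i\<bar>)"
  have p: "c i + p \<ge> 0" if "c \<in> C'" for c
  proof -
    have "\<bar>c i\<bar> \<le> p" unfolding p_def using that fin by (intro member_le_sum) auto
    then show ?thesis by linarith
  qed
  define s where "s c = c + smul p (unitv i)" for c
  have s_inj: "inj s" by (auto simp: s_def inj_def)
  have sz: "zvec m (s c)" "s c i \<ge> 0" if "c \<in> C'" for c
    using that C p[OF that] by (auto simp: C'_def s_def vec_apply)
  define K where "K = k + p * g (unitv i)"
  have gs: "f (Ev 1 i (s c)) = g c + p * g (unitv i)" for c
    by (simp add: s_def g_def Evec_add Evec_smul f.lin)
  \<comment> \<open>Absorbs the power of v that arises when \<open>X1 c\<close> is multiplied by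
    \<open>X1 (smul p (unitv i))\<close>.\<close>
  define b where "b c = a c * v powi bilin m L1 c (smul p (unitv i))" for c
  have bZ: "b c \<in> Zq v" if "c \<in> C'" for c
    using that C by (auto simp: b_def C'_def)
  have sum0: "(\<Sum>c\<in>C'. b c * X1 (s c)) = 0"
  proof -
    have "(\<Sum>c\<in>C'. b c * X1 (s c)) = (\<Sum>c\<in>C'. a c * X1 c) * X1 (smul p (unitv i))"
      unfolding sum_distrib_right
    proof (intro sum.cong refl)
      fix c assume "c \<in> C'"
      then have "zvec m c" using C by (auto simp: C'_def)
      then show "b c * X1 (s c) = a c * X1 c * X1 (smul p (unitv i))"
        using qruleD[OF q1, of c "smul p (unitv i)"] by (simp add: b_def s_def mult.assoc)
    qed
    also have "(\<Sum>c\<in>C'. a c * X1 c) = (\<Sum>c\<in>C. a c * X1 c)"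
      unfolding C'_def using C(1) by (intro sum.mono_neutral_left) auto
    finally show ?thesis using C(4) by simp
  qed
  have hiC: "(\<Sum>c\<in>C'-C0. b c * X1 (s c)) \<in> Sp X {e. f e > K}"
  proof (intro Sp_sum Sp_scale)
    fix c assume c: "c \<in> C' - C0"
    then have "g c > k" using kmin[of c] by (auto simp: C0_def)
    then show "X1 (s c) \<in> Sp X {e. f e > K}"
      using X1_ge_form[OF f.lin_form_axioms _ less_imp_le[OF pos] sz, of c] c gs[of c] by (auto simp: K_def intro: Sp_mono)
    show "b c \<in> Zq v" using bZ c by auto
  qed
  have "C' = C0 \<union> (C' - C0)" "C0 \<inter> (C' - C0) = {}" by (auto simp: C0_def)
  then have "(\<Sum>c\<in>C'. b c * X1 (s c)) = (\<Sum>c\<in>C0. b c * X1 (s c)) + (\<Sum>c\<in>C'-C0. b c * X1 (s c))"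
    using fin sum.union_disjoint[of C0 "C' - C0" "\<lambda>c. b c * X1 (s c)"] by simp
  then have "(\<Sum>c\<in>C0. b c * X1 (s c)) = - (\<Sum>c\<in>C'-C0. b c * X1 (s c))"
    using sum0 by (simp add: eq_neg_iff_add_eq_0)
  then have "(\<Sum>c\<in>C0. b c * X1 (s c)) \<in> Sp X {e. f e > K}"
    using Sp_uminus[OF hiC] by simp
  moreover have "(\<Sum>c\<in>C0. b c * X1 (s c)) = (\<Sum>e\<in>s ` C0. b (inv s e) * X1 e)"
    using s_inj by (simp add: sum.reindex inj_on_subset[OF s_inj])
  ultimately have hi: "(\<Sum>e\<in>s ` C0. b (inv s e) * X1 e) \<in> Sp X {e. f e > K}"
    by simp
  have "b (inv s (s c0)) = 0"
  proof (rule lead_zero[OF f.lin_form_axioms _ pos _ _ _ hi])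
    fix e assume "e \<in> s ` C0"
    then obtain c where e: "e = s c" "c \<in> C0" by auto
    then show "zvec m e \<and> e i \<ge> 0 \<and> f (Ev 1 i e) = K"
      using sz[of c] gs[of c] by (auto simp: C0_def K_def)
    show "b (inv s e) \<in> Zq v"
      using e bZ[of c] s_inj by (auto simp: C0_def)
  qed (use fin c0 in auto)
  then have "b c0 = 0" using s_inj by simp
  then show False using c0 v_nz by (auto simp: b_def C0_def C'_def)
qed

text \<open>The mutated pair is compatible with the same \<open>D\<close>. The contributions of c_i
  from column i and from the E-image of c cancel because D B is skew-symmetric.\<close>

lemma bilin_colv1:
  assumes l: "l \<in> {1..n}"
  shows "bilin m L1 c (colv m B1 l) = - c l * D l"
proof (cases "l = i")
  case True
  have "bilin m L1 c (colv m B1 i) = bilin m L (Ev 1 i c) (- colv m B i)"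
    using bil[of 1 c "- colv m B i"] colv_diag[OF i] by (simp add: col_i Evec_uminus Evec_fix)
  then show ?thesis
    using True by (simp add: bilin_linear bilin_colv[OF i])
next
  case False
  have *: "max (- B l i) 0 * D l = max (B i l) 0 * D i"
  proof -
    have e: "- B l i * D l = B i l * D i" using skew_symm[OF i l] by simp
    show ?thesis
    proof (cases "B i l \<ge> 0")
      case True
      then have "- B l i \<ge> 0" using sign_opposite[OF i l, of "-1"] by simp
      then show ?thesis using True e D_pos[OF i] by (auto simp: max_def)
    next
      case False
      then have "- B l i \<le> 0" using sign_opposite[OF i l, of 1] by simp
      then show ?thesis using False by (simp add: max_def)
    qed
  qed
  have "bilin m L1 c (colv m B1 l) = bilin m L (Ev 1 i c) (colv m B l + smul (max (B i l) 0) (colv m B i))"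
    using col_l[OF l False, of 1] bil[of 1 c "colv m B1 l"] by simp
  also have "\<dots> = - Ev 1 i c l * D l + max (B i l) 0 * (c i * D i)"
    by (simp add: bilin_linear bilin_colv[OF l] bilin_colv[OF i])
  also have "Ev 1 i c l = c l + max (- B l i) 0 * c i"
    using False in_m[OF l] by (simp add: Evec_def)
  also have "- (c l + max (- B l i) 0 * c i) * D l + max (B i l) 0 * (c i * D i)
      = - c l * D l - c i * (max (- B l i) 0 * D l - max (B i l) 0 * D i)"
    by (simp add: algebra_simps)
  finally show ?thesis unfolding * by simp
qed

lemma B1_i: "k \<in> {1..m} \<Longrightarrow> B1 k i = - B k i"
  using fun_cong[OF col_i, of k] by (simp add: colv_def vec_apply)

text \<open>The way back with sign t uses the matrix E of sign -t. As E is its own inverse, the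
  mutation at i becomes an involution (\<open>mutated_back\<close>).\<close>

lemma Evec_B1: "Evec m t B1 i c = Evec m (- t) B i c"
  by (auto simp: Evec_def fun_eq_iff B1_i)

lemma seed1: "indep_seed m v n d L1 B1 X1 h"
proof
  have L1: "L1 k l = bilin m L1 (unitv k) (unitv l)" if "k \<in> {1..m}" "l \<in> {1..m}" for k l
    using bilin_unitv[OF that] by simp
  show "compatible m n L1 B1"
    unfolding compatible_def
  proof (intro conjI exI[of _ D] ballI)
    show "L1 k l = - L1 l k" if "k \<in> {1..m}" "l \<in> {1..m}" for k l
      using L1[OF that] L1[OF that(2,1)] bil[of 1 "unitv k" "unitv l"] bil[of 1 "unitv l" "unitv k"]
        skew[of "Ev 1 i (unitv k)" "Ev 1 i (unitv l)"] by simp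
    show "0 < D k" if "k \<in> {1..n}" for k using D_pos[OF that] .
    show "(\<Sum>j\<in>{1..m}. L1 k j * B1 j l) = (if k = l then - D k else 0)"
      if kl: "k \<in> {1..m}" "l \<in> {1..n}" for k l
    proof -
      have "bilin m L1 (unitv k) (colv m B1 l)
          = (\<Sum>a\<in>{1..m}. if a = k then \<Sum>j\<in>{1..m}. L1 a j * B1 j l else 0)"
        unfolding bilin_def colv_def unitv_def by (intro sum.cong) auto
      then have "bilin m L1 (unitv k) (colv m B1 l) = (\<Sum>j\<in>{1..m}. L1 k j * B1 j l)"
        using kl(1) by simp
      then show ?thesis
        using bilin_colv1[OF kl(2), of "unitv k"] by (auto simp: unitv_def)
    qed
  qed
  have dv: "int (d l) dvd B k l" if "k \<in> {1..m}" "l \<in> {1..n}" for k l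
    using dok that by (simp add: d_ok_def)
  have "int (d l) dvd B1 k l" if kl: "k \<in> {1..m}" "l \<in> {1..n}" for k l
  proof (cases "l = i")
    case True
    then show ?thesis using dv[OF kl] B1_i[OF kl(1)] by simp
  next
    case False
    have mx: "int (d l) dvd max (B i l) 0"
      using dv[OF i_m kl(2)] by (simp add: max_def)
    have "B1 k l = Ev 1 i (colv m B l + smul (max (B i l) 0) (colv m B i)) k"
      using fun_cong[OF col_l[OF kl(2) False, of 1], of k] kl by (simp add: colv_def)
    also have "int (d l) dvd \<dots>"
      using dv[OF kl] dv[OF i_m kl(2)] mx kl i_m
      by (auto simp: Evec_def colv_def vec_apply intro!: dvd_add dvd_mult dvd_mult2)
    finally show ?thesis .
  qed
  then show "d_ok m n d B1"
    using d_pos by (auto simp: d_ok_def)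
qed (fact nm hok q1 indep1)+

sublocale s1: indep_seed m v n d L1 B1 X1 h
  by (rule seed1)

lemma bet_B1: "s1.bet i = - bet i"
proof
  fix k
  have "smul (int (d i)) (s1.bet i) = smul (int (d i)) (- bet i)"
    using s1.d_betav[OF i] d_betav[OF i] col_i by (simp add: fun_eq_iff vec_apply)
  then have "int (d i) * s1.bet i k = int (d i) * (- bet i) k"
    by (simp add: fun_eq_iff vec_apply)
  then show "s1.bet i k = (- bet i) k"
    using d_pos[OF i] by (metis mult_left_cancel of_nat_0_less_iff less_irrefl)
qed

text \<open>After multiplication by \<open>X1 (unitv i)\<close> on the right every exponent has i-th
  coordinate 0, where both seeds agree. The product becomes X_i times the exchange polynomial, which
  is \<open>X1 (unitv i)\<close> itself and cancels.\<close>

lemma mut_var_back: "s1.mv i = X (unitv i)"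
proof -
  define w where "w r = Ev (- 1) i (unitv i) + smul (int r * (- 1)) (bet i)" for r
  have w: "zvec m (w r)" for r using i_m by (simp add: w_def)
  have mv: "mv i = (\<Sum>r\<in>{0..d i}. h i r * X (w r))"
    unfolding w_def by (rule mut_var_form[OF i]) simp
  have "s1.mv i = (\<Sum>r\<in>{0..d i}. h i r * X1 (w r))"
    unfolding s1.mut_var_form[OF i, of 1, simplified] Evec_B1 bet_B1 w_def
    by (intro sum.cong refl arg_cong2[where f = "(*)"] arg_cong[where f = X1])
       (simp add: fun_eq_iff vec_apply)
  then have "s1.mv i * X1 (unitv i) = (\<Sum>r\<in>{0..d i}. h i r * (X1 (w r) * X1 (unitv i)))"
    by (simp add: sum_distrib_right mult.assoc)
  also have "\<dots> = (\<Sum>r\<in>{0..d i}. h i r * (X (unitv i) * X (w r)))"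
  proof (intro sum.cong refl)
    fix r
    let ?u = "Ev (- 1) i (unitv i)"
    have "(w r + unitv i) i = 0"
      by (simp add: w_def vec_apply betav_diag[OF i])
    then have X: "X1 (w r + unitv i) = X (unitv i + w r)"
      using X1_off[of "w r + unitv i"] w by (simp add: add.commute)
    have "Ev (- 1) i (w r) = unitv i + smul (int r * (- 1)) (bet i)"
      by (simp add: w_def Evec_add Evec_smul Evec_fix betav_diag[OF i])
    then have "bilin m L1 (w r) (unitv i) = bilin m L (unitv i) (w r)"
      using bil[of "- 1" "w r" "unitv i"]
      by (simp add: w_def bilin_linear bilin_betav[OF i] bilin_betav_left[OF i])
    then show "h i r * (X1 (w r) * X1 (unitv i)) = h i r * (X (unitv i) * X (w r))"
      using qruleD[OF q1 w i_z] qruleD[OF q i_z w] X by simp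
  qed
  also have "\<dots> = X (unitv i) * mv i"
    unfolding mv sum_distrib_left
  proof (intro sum.cong refl)
    fix r assume r: "r \<in> {0..d i}"
    then have "h i r * X (unitv i) = X (unitv i) * h i r" using Zq_comm[OF h_Zq[OF i]] by simp
    then show "h i r * (X (unitv i) * X (w r)) = X (unitv i) * (h i r * X (w r))"
      by (metis mult.assoc)
  qed
  finally show ?thesis
    using X1_nz[OF i_z] by (simp add: X1_i)
qed

lemma mutated_back: "mutated m v n d L1 B1 X1 h i L B X"
proof
  have pm: "- t \<in> {1, -1}" if "t \<in> {1, - 1 :: int}" for t using that by auto
  show "bilin m L c e = bilin m L1 (Evec m t B1 i c) (Evec m t B1 i e)" if "t \<in> {1, -1}" for t c e
    unfolding Evec_B1 bil[OF pm[OF that]] by simp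
  show "colv m B i = - colv m B1 i"
    by (simp add: col_i)
  show "colv m B l = Evec m t B1 i (colv m B1 l + smul (max (t * B1 i l) 0) (colv m B1 i))"
    if "l \<in> {1..n}" "l \<noteq> i" "t \<in> {1, -1}" for l t
  proof -
    have "colv m B1 l i = - B i l"
      using fun_cong[OF col_l[OF that(1,2), of 1], of i] colv_diag[OF i] i_m
      by (simp add: colv_def vec_apply)
    then have B1: "B1 i l = - B i l"
      using i_m by (simp add: colv_def)
    show ?thesis
      unfolding Evec_B1 B1 col_i using col_l[OF that(1,2) pm[OF that(3)]] colv_diag[OF i]
      by (simp add: Evec_linear Evec_fix smul_uminus)
  qed
  show "X (unitv i) = mut_var m d (X1, h, L1, B1) i"
    by (simp add: mut_var_back)
qed (use i q X1_unit in auto)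

lemma X_coord:
  assumes "zvec m c" "c i \<ge> 0"
  shows "X c \<in> Sp X1 {e. e i = - c i}"
  using mutated.X1_coord[OF mutated_back assms] .

text \<open>Split y = a + b by the sign of the exponent of X_i and y = z + w by that of X'_i. Then b
  - z = w - a. Multiplied by a suitable N-th power of X'_i, the left side has degree below -N in
  X_i, while the right side is a polynomial of degree at most N in X'_i and has degree at least -N
  in X_i. Hence both vanish and y = a + z.\<close>

lemma Sp_Int_decomp:
  assumes y: "y \<in> Sp X UNIV" "y \<in> Sp X1 UNIV"
  shows "\<exists>y1 y2. y1 \<in> Sp X {c. c i \<ge> 0} \<and> y2 \<in> Sp X1 {c. c i \<ge> 0} \<and> y = y1 + y2"
proof -
  obtain a b where ab: "a \<in> Sp X {c. c i \<ge> 0}" "b \<in> Sp X {c. \<not> c i \<ge> 0}" "y = a + b"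
    using Sp_split[OF y(1), of "\<lambda>c. c i \<ge> 0"] by auto
  obtain z w where zw: "z \<in> Sp X1 {c. c i > 0}" "w \<in> Sp X1 {c. \<not> c i > 0}" "y = z + w"
    using Sp_split[OF y(2), of "\<lambda>c. c i > 0"] by auto
  \<comment> \<open>X_i is the new variable of the mutation back, so nonnegative exponents of X_i
    become nonpositive exponents of X'_i.\<close>
  have "a \<in> Sp X1 {c. \<not> c i > 0}"
    using ab(1) by (rule Sp_map) (rule Sp_mono[OF X_coord], auto)
  then have "w - a \<in> Sp X1 {c. \<not> c i > 0}"
    using zw(2) by (intro Sp_diff)
  then obtain N :: nat where N: "w - a \<in> Sp X1 {c \<in> {c. \<not> c i > 0}. \<bar>c i\<bar> \<le> int N}"
    using Sp_bounded[of "w - a" X1 _ "\<lambda>c. c i"] by blast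
  have "z \<in> Sp X {c. \<not> c i \<ge> 0}"
    using zw(1) by (rule Sp_map) (rule Sp_mono[OF X1_coord], auto)
  then have bz: "b - z \<in> Sp X {c. \<not> c i \<ge> 0}"
    using ab(2) by (intro Sp_diff)
  let ?p = "smul (int N) (unitv i)"
  have "X1 ?p \<in> Sp X {e. e i = - int N}"
    using X1_coord[of ?p] by (simp add: vec_apply)
  then have 1: "(b - z) * X1 ?p \<in> Sp X {e. e i < - int N}"
    by (rule Sp_mult[OF q bz]) (auto simp: vec_apply)
  have "X1 ?p \<in> Sp X1 {?p}"
    by (intro Sp_X) auto
  then have "(w - a) * X1 ?p \<in> Sp X1 {c. 0 \<le> c i \<and> c i \<le> int N}"
    by (rule Sp_mult[OF q1 N]) (auto simp: vec_apply)
  then have 2: "(w - a) * X1 ?p \<in> Sp X {c. - int N \<le> c i}"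
    by (rule Sp_map) (rule Sp_mono[OF X1_coord], auto)
  have eq: "w - a = b - z" using ab(3) zw(3) by (simp add: algebra_simps)
  have "(b - z) * X1 ?p = 0"
    using 2 unfolding eq by (rule Sp_disjoint[OF ind 1]) auto
  then have "b = z" using X1_nz[of ?p] by simp
  moreover have "z \<in> Sp X1 {c. c i \<ge> 0}"
    using zw(1) by (rule Sp_mono) auto
  ultimately show ?thesis using ab by blast
qed

end

section \<open>Two mutations in different directions\<close>

text \<open>The lowest component of y is multiplied by the invertible monomial \<open>X w\<close>,
  so it cannot disappear and its degree rises by exactly f w. The induction improves an a priori
  bound k - N by one in each step.\<close>

lemma (in indep_seed) mult_ge:
  assumes "lin_form f" and w: "zvec m w" and z: "z - X w \<in> Sp X {e. f e > f w}"
    and y: "y \<in> Sp X UNIV" and zy: "z * y \<in> Sp X {e. f e \<ge> f w + k}"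
  shows "y \<in> Sp X {e. f e \<ge> k}"
proof -
  interpret f: lin_form f by fact
  have ww: "X w \<in> Sp X {w}" using w by (intro Sp_X) auto
  have zge: "z \<in> Sp X {e. f e \<ge> f w}"
    using Sp_add[OF Sp_mono[OF z, of "{e. f e \<ge> f w}"] Sp_mono[OF ww, of "{e. f e \<ge> f w}"]] by auto
  have "x \<in> Sp X {e. f e \<ge> k - int N} \<Longrightarrow> z * x \<in> Sp X {e. f e \<ge> f w + k} \<Longrightarrow> x \<in> Sp X {e. f e \<ge> k}" for N x
  proof (induction N)
    case 0
    then show ?case by simp
  next
    case (Suc N)
    let ?k = "k - int (Suc N)"
    obtain x0 x1 where x: "x0 \<in> Sp X {c\<in>{e. f e \<ge> ?k}. f c = ?k}" "x1 \<in> Sp X {c\<in>{e. f e \<ge> ?k}. f c \<noteq> ?k}"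
      "x = x0 + x1" using Sp_split[OF Suc.prems(1), of "\<lambda>c. f c = ?k"] by blast
    have 1: "X w * x0 \<in> Sp X {e. f e = f w + ?k}"
      by (rule Sp_mult[OF q ww x(1)]) (auto simp: f.lin)
    have "(z - X w) * x0 \<in> Sp X {e. f e > f w + ?k}"
      by (rule Sp_mult[OF q z x(1)]) (auto simp: f.lin)
    moreover have "z * x1 \<in> Sp X {e. f e > f w + ?k}"
      by (rule Sp_mult[OF q zge x(2)]) (auto simp: f.lin)
    moreover have "z * x \<in> Sp X {e. f e > f w + ?k}"
      using Suc.prems(2) by (rule Sp_mono) auto
    ultimately have "z * x - z * x1 - (z - X w) * x0 \<in> Sp X {e. f e > f w + ?k}"
      by (intro Sp_diff)
    moreover have "z * x - z * x1 - (z - X w) * x0 = X w * x0"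
      unfolding x(3) by (simp add: algebra_simps)
    ultimately have "X w * x0 = 0"
      by (intro Sp_disjoint[OF ind 1, of "{e. f e > f w + ?k}"]) auto
    then have "x = x1" using X_nz[OF w] x(3) by simp
    then have "x \<in> Sp X {e. f e \<ge> k - int N}"
      using x(2) by (auto intro: Sp_mono)
    then show ?case using Suc by blast
  qed
  moreover obtain M :: nat where M: "y \<in> Sp X {c\<in>UNIV. \<bar>f c\<bar> \<le> int M}"
    using Sp_bounded[OF y, of f] by blast
  have "y \<in> Sp X {e. f e \<ge> k - int (nat (\<bar>k\<bar> + int M))}"
    using M by (rule Sp_mono) auto
  ultimately show ?thesis using zy by blast
qed

text \<open>The maps \<open>Xi\<close>, \<open>Xj\<close> and \<open>Xij\<close> stand for mu_i X,
  mu_j X and mu_j (mu_i X); a sign \<open>t\<close> with \<open>sgn\<close> exists for every value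
  of b_ij.\<close>

locale mutation_pair =
  a: mutated m v n d L B X h i Li Bi Xi +
  b: mutated m v n d L B X h j Lj Bj Xj +
  c: mutated m v n d Li Bi Xi h j Lij Bij Xij
  for m :: nat and v :: "'f::division_ring" and n d L B X h i j Li Bi Xi Lj Bj Xj Lij Bij Xij +
  fixes t :: int
  assumes ij: "i \<noteq> j" and t: "t \<in> {1, -1}" and sgn: "t * B i j \<le> 0"
begin

abbreviation E :: "(nat \<Rightarrow> int) \<Rightarrow> nat \<Rightarrow> int" where
  "E \<equiv> Evec m t B i"

definition u :: "nat \<Rightarrow> int" where
  "u = E (unitv i)"

definition f :: "(nat \<Rightarrow> int) \<Rightarrow> int" where
  "f = (\<lambda>c. - t * bilin m L (unitv i) c)"

text \<open>For c_i >= 0 this is the degree of the lowest term of \<open>Xi c\<close>; it then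
  serves as a degree on all exponents of \<open>Xi\<close>.\<close>

definition g :: "(nat \<Rightarrow> int) \<Rightarrow> int" where
  "g c = f (E c)"

text \<open>The degree of the homogeneous element \<open>Xj c\<close> for c_j >= 0. Both signs give
  the same value: the two images differ by a multiple of column j, on which \<open>f\<close>
  vanishes.\<close>

definition fj :: "(nat \<Rightarrow> int) \<Rightarrow> int" where
  "fj c = f (Evec m 1 B j c)"

lemma f_lin: "lin_form f"
  unfolding f_def by (rule lin_form_bilin)

sublocale f: lin_form f
  by (rule f_lin)

sublocale g: lin_form g
  by standard (simp_all add: g_def Evec_linear f.lin)

sublocale fj: lin_form fj
  by standard (simp_all add: fj_def Evec_linear f.lin)

lemma tt: "t * t = 1"
  using t by auto

lemma f_beti: "t * f (betav m d B i) > 0"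
proof -
  have "t * f (betav m d B i) = (t * t) * a.Dt i"
    by (simp add: f_def a.bilin_betav[OF a.i])
  then show ?thesis
    using a.Dt_pos[OF a.i] by (simp add: tt)
qed

lemma f_betj: "f (betav m d B j) = 0"
  using ij by (simp add: f_def a.bilin_betav[OF b.i] unitv_def)

lemma sgn': "t * B j i \<ge> 0"
  using a.sign_opposite[OF a.i b.i] sgn by blast

lemma E_j: "E c j = c j"
  using ij sgn' b.i_m by (simp add: Evec_def)

lemma u_z [simp]: "zvec m u"
  by (simp add: u_def)

lemma ej_i [simp]: "unitv j i = 0"
  using ij by (auto simp: unitv_def)

lemma E_add_ei: "E (E e + smul q (unitv i)) = e + smul q u"
  by (simp add: Evec_linear u_def)

lemma colv_Bi: "colv m Bi j = E (colv m B j)"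
  using a.col_l[OF b.i ij[symmetric] t] sgn by (simp add: max_def)

lemma betav_Bi: "betav m d Bi j = E (betav m d B j)"
proof
  fix k
  have "smul (int (d j)) (betav m d Bi j) = smul (int (d j)) (E (betav m d B j))"
    using a.s1.d_betav[OF b.i] a.d_betav[OF b.i] colv_Bi by (simp add: Evec_smul[symmetric])
  then have "int (d j) * betav m d Bi j k = int (d j) * E (betav m d B j) k"
    by (auto simp: fun_eq_iff vec_apply)
  then show "betav m d Bi j k = E (betav m d B j) k"
    using a.d_pos[OF b.i] by simp
qed

section \<open>The new variable at j after the mutation at i, and its lowest component\<close>

definition cv :: "nat \<Rightarrow> nat \<Rightarrow> int" where
  "cv r = mut_vec m d Bi j r"

text \<open>E turns the exchange exponents at j after the mutation at i into those before it,
  translated by this fixed vector (\<open>E_cv\<close>).\<close>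

definition delta :: "nat \<Rightarrow> int" where
  "delta = E (Evec m 1 Bi j (unitv j)) - Evec m 1 B j (unitv j)"

text \<open>The common degree of all monomials of \<open>xlead\<close>
  (\<open>f_E_cv\<close>).\<close>

definition kap :: int where
  "kap = f (E (Evec m 1 Bi j (unitv j)))"

lemma delta_z [simp]: "zvec m delta"
  by (simp add: delta_def)

lemma delta_j: "delta j = 0"
  by (simp add: delta_def vec_apply E_j)

lemma cv_z [simp]: "r \<le> d j \<Longrightarrow> zvec m (cv r)"
  using a.s1.mut_vec_pos[OF b.i, of r] by (simp add: cv_def)

lemma cv_i: "cv r i \<ge> 0"
  using a.i_m by (simp add: cv_def mut_vec_def)

lemma cv_j: "r \<le> d j \<Longrightarrow> cv r j = - 1"
  using a.s1.mut_vec_pos[OF b.i, of r] a.s1.betav_diag[OF b.i] by (simp add: cv_def vec_apply)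

lemma E_cv: "r \<le> d j \<Longrightarrow> E (cv r) = delta + (Evec m 1 B j (unitv j) + smul (int r) (betav m d B j))"
  using a.s1.mut_vec_pos[OF b.i, of r] by (simp add: cv_def betav_Bi Evec_linear delta_def)

lemma f_E_cv: "r \<le> d j \<Longrightarrow> f (E (cv r)) = kap"
  by (simp add: E_cv f.lin f_betj) (simp add: delta_def kap_def f.lin)

lemma g_cv: "r \<le> d j \<Longrightarrow> g (cv r) = kap"
  by (simp add: g_def f_E_cv)

abbreviation xij :: 'f where
  "xij \<equiv> Xij (unitv j)"

lemma xij_sum: "xij = (\<Sum>r\<in>{0..d j}. h j r * Xi (cv r))"
  by (simp add: c.X1_i mut_var_def cv_def)

definition xlead :: 'f where
  "xlead = (\<Sum>r\<in>{0..d j}. h j r * X (E (cv r)))"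

text \<open>Translation by \<open>delta\<close> becomes multiplication by \<open>X delta\<close>.
  Since \<open>delta\<close> vanishes at j, it pairs to 0 with beta_j, so the same power of v arises
  for every r and the old exchange polynomial factors out.\<close>

lemma xlead_eq: "\<exists>s. xlead = v powi s * Xj (delta + unitv j)"
proof -
  define w where "w r = Evec m 1 B j (unitv j) + smul (int r * 1) (betav m d B j)" for r
  define s where "s = - bilin m L delta (Evec m 1 B j (unitv j))"
  have wz: "zvec m (w r)" for r by (simp add: w_def)
  have "xlead = (\<Sum>r\<in>{0..d j}. v powi s * (X delta * (h j r * X (w r))))"
    unfolding xlead_def
  proof (intro sum.cong refl)
    fix r assume r: "r \<in> {0..d j}"
    have "bilin m L delta (w r) = - s"
      by (simp add: w_def s_def bilin_linear a.bilin_betav[OF b.i] delta_j)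
    then have "X (E (cv r)) = v powi s * (X delta * X (w r))"
      using a.qrule_add[OF a.q delta_z wz, of r] E_cv[of r] r by (simp add: w_def)
    then have "h j r * X (E (cv r)) = v powi s * ((h j r * X delta) * X (w r))"
      by (simp add: a.vp_simps mult.assoc)
    moreover have comm: "h j r * X delta = X delta * h j r"
      using a.Zq_comm[OF a.h_Zq[OF b.i]] r by simp
    ultimately show "h j r * X (E (cv r)) = v powi s * (X delta * (h j r * X (w r)))"
      unfolding comm by (simp add: mult.assoc)
  qed
  also have "\<dots> = v powi s * (X delta * a.mv j)"
    unfolding a.mut_var_form[OF b.i insertI1] w_def by (simp add: sum_distrib_left)
  also have "\<dots> = v powi s * (v powi bilin m Lj delta (unitv j) * Xj (delta + unitv j))"
    using b.X1_off[OF delta_z delta_j] b.X1_i a.qruleD[OF b.q1 delta_z b.i_z] by simp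
  finally show ?thesis
    by (metis a.vp_add mult.assoc)
qed

lemma xij_lead: "xij - xlead \<in> a.Sp X {e. f e > kap}"
proof -
  have "xij - xlead = (\<Sum>r\<in>{0..d j}. h j r * (Xi (cv r) - X (E (cv r))))"
    by (simp add: xij_sum xlead_def sum_subtractf right_diff_distrib)
  also have "\<dots> \<in> a.Sp X {e. f e > kap}"
  proof (intro a.Sp_sum a.Sp_scale)
    fix r assume "r \<in> {0..d j}"
    then show "Xi (cv r) - X (E (cv r)) \<in> a.Sp X {e. f e > kap}" "h j r \<in> Zq v"
      using a.X1_lead_form[OF f_lin t f_beti, of "cv r"] cv_i[of r] f_E_cv[of r] a.h_Zq[OF b.i] by auto
  qed
  finally show ?thesis .
qed

lemma fj_lead: "fj (delta + unitv j) = kap"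
  by (simp add: fj_def Evec_add Evec_fix delta_j kap_def) (simp add: delta_def)

lemma Xj_hom: "zvec m c \<Longrightarrow> c j \<ge> 0 \<Longrightarrow> Xj c \<in> a.Sp X {e. f e = fj c}"
  unfolding fj_def using b.X1_homogeneous[OF f_lin _ f_betj, of 1] by simp

lemma X_in_Xj: "y \<in> a.Sp X {e. e j \<ge> 0} \<Longrightarrow> y \<in> a.Sp Xj UNIV"
  by (erule a.Sp_map) (rule a.Sp_mono[OF b.X_coord], auto)

lemma t_bet_j: "t * betav m d B i j \<ge> 0"
proof -
  have "int (d i) * (t * betav m d B i j) = t * B j i"
    using fun_cong[OF a.d_betav[OF a.i], of j] b.i_m by (simp add: vec_apply colv_def algebra_simps)
  then show ?thesis
    using sgn' a.d_pos[OF a.i] by (metis zero_le_mult_iff of_nat_0_less_iff not_le)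
qed

lemma Xi_ge_j: "zvec m c \<Longrightarrow> c i \<ge> 0 \<Longrightarrow> Xi c \<in> a.Sp X {e. e j \<ge> c j}"
  using a.X1_ge_form[OF lin_form_coord[of j] t t_bet_j, of c] by (simp add: E_j)

lemma Xi_in_Xj: "zvec m c \<Longrightarrow> c i \<ge> 0 \<Longrightarrow> c j \<ge> 0 \<Longrightarrow> Xi c \<in> a.Sp Xj UNIV"
  by (rule X_in_Xj, rule a.Sp_mono[OF Xi_ge_j]) auto

text \<open>Some monomials of \<open>xij\<close> in X contain the inverse of X_j. They occur only in
  \<open>xlead\<close>, which as a whole is a monomial of \<open>Xj\<close>; all other terms have
  nonnegative exponent at j.\<close>

lemma xij_in_Xj: "xij \<in> a.Sp Xj UNIV"
proof -
  have "xij - xlead \<in> a.Sp X {e. e j \<ge> 0}"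
  \<comment> \<open>If b_ji = 0, nothing lies above \<open>xlead\<close>. Otherwise the j-th entry
    of beta_i has sign t, and moving up the line raises the exponent at j above -1.\<close>
  proof (cases "B j i = 0")
    case True
    then have "B i j = 0"
      using a.skew_symm[OF a.i b.i] a.D_pos[OF a.i] by simp
    then have "Bi i j = 0"
      using fun_cong[OF colv_Bi, of i] a.i_m by (simp add: colv_def)
    then have cv0: "cv r i = 0" for r
      using ij by (simp add: cv_def mut_vec_def)
    have "xij = xlead"
      unfolding xij_sum xlead_def
      by (intro sum.cong refl) (simp add: cv0 a.X1_off Evec_fix)
    then show ?thesis by (simp add: a.Sp.zero)
  next
    case False
    have "int (d i) * betav m d B i j = B j i"
      using fun_cong[OF a.d_betav[OF a.i], of j] b.i_m by (simp add: vec_apply colv_def)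
    then have "t * betav m d B i j \<noteq> 0" using False t by auto
    then have pos: "t * betav m d B i j > 0" using t_bet_j by (simp add: less_le)
    have "xij - xlead = (\<Sum>r\<in>{0..d j}. h j r * (Xi (cv r) - X (E (cv r))))"
      by (simp add: xij_sum xlead_def sum_subtractf right_diff_distrib)
    also have "\<dots> \<in> a.Sp X {e. e j \<ge> 0}"
    proof (intro a.Sp_sum a.Sp_scale)
      fix r assume r: "r \<in> {0..d j}"
      then have "Xi (cv r) - X (E (cv r)) \<in> a.Sp X {e. e j > - 1}"
        using a.X1_lead_form[OF lin_form_coord[of j] t pos, of "cv r"] cv_i[of r] cv_j[of r]
        by (auto simp: E_j)
      then show "Xi (cv r) - X (E (cv r)) \<in> a.Sp X {e. e j \<ge> 0}"
        by (rule a.Sp_mono) auto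
      show "h j r \<in> Zq v" using r a.h_Zq[OF b.i] by auto
    qed
    finally show ?thesis .
  qed
  moreover obtain s where "xlead = v powi s * Xj (delta + unitv j)"
    using xlead_eq by blast
  then have "xlead \<in> a.Sp Xj UNIV"
    by (simp add: a.Sp_monom)
  ultimately show ?thesis
    using a.Sp_add[OF X_in_Xj, of "xij - xlead" xlead] by simp
qed

lemma one_in: "1 \<in> a.Sp Xi {0}" "1 \<in> a.Sp Xij UNIV" "1 \<in> a.Sp Xj UNIV"
  using a.Sp_X[of 0 "{0}" Xi] a.Sp_X[of 0 UNIV Xij] a.Sp_X[of 0 UNIV Xj] by simp_all

lemma xij_pow:
  "xij ^ l \<in> a.Sp Xi {c. c i \<ge> 0 \<and> g c = int l * kap}"
  "xij ^ l \<in> a.Sp Xij UNIV" "xij ^ l \<in> a.Sp Xj UNIV"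
proof -
  have x: "xij \<in> a.Sp Xi {c. c i \<ge> 0 \<and> g c = kap}"
    unfolding xij_sum using cv_i g_cv a.h_Zq[OF b.i] by (intro a.Sp_sum a.Sp_monom) auto
  show "xij ^ l \<in> a.Sp Xi {c. c i \<ge> 0 \<and> g c = int l * kap}"
  proof (induction l)
    case 0
    show ?case using one_in(1) by (simp, rule a.Sp_mono) (auto simp: vec_apply)
  next
    case (Suc l)
    show ?case unfolding power_Suc
      by (rule a.Sp_mult[OF a.q1 x Suc]) (auto simp: g.lin vec_apply algebra_simps)
  qed
  have x2: "xij \<in> a.Sp Xij UNIV"
    by (intro a.Sp_X) auto
  show "xij ^ l \<in> a.Sp Xij UNIV"
  proof (induction l)
    case (Suc l)
    show ?case unfolding power_Suc by (rule a.Sp_mult[OF c.q1 x2 Suc]) auto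
  qed (simp add: one_in)
  show "xij ^ l \<in> a.Sp Xj UNIV"
  proof (induction l)
    case (Suc l)
    show ?case unfolding power_Suc by (rule a.Sp_mult[OF b.q1 xij_in_Xj Suc]) auto
  qed (simp add: one_in)
qed

lemma Sp_lead_mult:
  assumes "A - A0 \<in> a.Sp X {e. f e > k}" "B1 - B0 \<in> a.Sp X {e. f e > l}"
    and "A0 \<in> a.Sp X {e. f e = k}" "B0 \<in> a.Sp X {e. f e = l}"
  shows "A * B1 - A0 * B0 \<in> a.Sp X {e. f e > k + l}"
proof -
  have A: "A \<in> a.Sp X {e. f e \<ge> k}"
    using a.Sp_add[OF a.Sp_mono[OF assms(1), of "{e. f e \<ge> k}"] a.Sp_mono[OF assms(3), of "{e. f e \<ge> k}"]]
    by auto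
  have "A * (B1 - B0) + (A - A0) * B0 \<in> a.Sp X {e. f e > k + l}"
    by (intro a.Sp_add a.Sp_mult[OF a.q A assms(2)] a.Sp_mult[OF a.q assms(1,4)]) (auto simp: f.lin)
  then show ?thesis by (simp add: algebra_simps)
qed

lemma xij_pow_lead:
  "\<exists>s. xij ^ l - v powi s * Xj (smul (int l) (delta + unitv j)) \<in> a.Sp X {e. f e > int l * kap}"
proof -
  let ?c = "delta + unitv j"
  have cz: "zvec m (smul r ?c)" for r by simp
  obtain s where s: "xlead = v powi s * Xj ?c" using xlead_eq by blast
  have l1: "xlead \<in> a.Sp X {e. f e = kap}"
    unfolding s using Xj_hom[of ?c] by (intro a.Sp_scale) (auto simp: fj_lead delta_j vec_apply)
  show ?thesis
  proof (induction l)
    case 0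
    then show ?case by (auto intro!: exI[of _ 0] a.Sp.zero)
  next
    case (Suc l)
    then obtain s' where s': "xij ^ l - v powi s' * Xj (smul (int l) ?c) \<in> a.Sp X {e. f e > int l * kap}"
      by blast
    have "Xj (smul (int l) ?c) \<in> a.Sp X {e. f e = int l * kap}"
      using Xj_hom[OF cz, of "int l"] by (simp add: fj.lin fj_lead[unfolded fj.add] delta_j vec_apply)
    then have l2: "v powi s' * Xj (smul (int l) ?c) \<in> a.Sp X {e. f e = int l * kap}"
      by (intro a.Sp_scale) auto
    have "xij * xij ^ l - xlead * (v powi s' * Xj (smul (int l) ?c)) \<in> a.Sp X {e. f e > kap + int l * kap}"
      by (rule Sp_lead_mult[OF xij_lead s' l1 l2])
    moreover have "xlead * (v powi s' * Xj (smul (int l) ?c))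
        = v powi (s + s' + bilin m Lj ?c (smul (int l) ?c)) * Xj (smul (int (Suc l)) ?c)"
    proof -
      have "Xj ?c * Xj (smul (int l) ?c) = v powi bilin m Lj ?c (smul (int l) ?c) * Xj (smul (int (Suc l)) ?c)"
        using a.qruleD[OF b.q1, of ?c "smul (int l) ?c"] cz by (simp add: smul_add_left)
      then show ?thesis
        unfolding s by (simp add: a.vp_simps mult.assoc) (simp add: a.vp_simps algebra_simps)
    qed
    ultimately show ?case by (auto simp: algebra_simps)
  qed
qed

text \<open>Here \<open>y\<close> is meant to be \<open>f\<close>-homogeneous of degree \<open>k\<close>; the power \<open>r\<close> of the new variable
  at \<open>i\<close>, whose lowest monomial is \<open>X(u)\<close>, makes the exponents of \<open>G\<close> at \<open>i\<close> nonnegative.\<close>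

definition lift_of :: "int \<Rightarrow> nat \<Rightarrow> 'f \<Rightarrow> 'f \<Rightarrow> bool" where
  "lift_of k r y G \<longleftrightarrow> G \<in> a.Sp Xi {c. c i \<ge> 0 \<and> g c = k + int r * g (unitv i)}
     \<and> G \<in> a.Sp Xij UNIV \<and> G \<in> a.Sp Xj UNIV
     \<and> G - X (smul (int r) u) * y \<in> a.Sp X {e. f e > k + int r * g (unitv i)}"

text \<open>All large r are demanded, so that the lifts of several summands can share one r and r
  can still be enlarged in \<open>pair_step\<close>.\<close>

definition liftable :: "int \<Rightarrow> 'f \<Rightarrow> bool" where
  "liftable k y \<longleftrightarrow> (\<exists>p. \<forall>r\<ge>p. \<exists>G. lift_of k r y G)"

lemma liftable_0: "liftable k 0"
  unfolding liftable_def lift_of_def by (intro exI[of _ 0] allI impI exI[of _ 0]) (auto intro: a.Sp.zero)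

lemma lift_of_add:
  assumes "lift_of k r y G" "lift_of k r z H"
  shows "lift_of k r (y + z) (G + H)"
proof -
  have "(G - X (smul (int r) u) * y) + (H - X (smul (int r) u) * z)
      \<in> a.Sp X {e. f e > k + int r * g (unitv i)}"
    using assms unfolding lift_of_def by (intro a.Sp_add) auto
  then show ?thesis
    using assms unfolding lift_of_def by (auto intro: a.Sp_add simp: algebra_simps)
qed

lemma liftable_add:
  assumes "liftable k y" "liftable k z"
  shows "liftable k (y + z)"
proof -
  obtain p p' where "\<forall>r\<ge>p. \<exists>G. lift_of k r y G" "\<forall>r\<ge>p'. \<exists>G. lift_of k r z G"
    using assms unfolding liftable_def by blast
  then have "\<forall>r\<ge>max p p'. \<exists>G. lift_of k r (y + z) G"
    using lift_of_add by (meson max.boundedE)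
  then show ?thesis unfolding liftable_def by blast
qed

lemma lift_of_scale:
  assumes G: "lift_of k r y G" and b: "b \<in> Zq v"
  shows "lift_of k r (b * y) (b * G)"
proof -
  have "b * G - X (smul (int r) u) * (b * y) = b * (G - X (smul (int r) u) * y)"
    using a.Zq_comm[OF b, of "X (smul (int r) u)"] by (simp add: right_diff_distrib mult.assoc[symmetric])
  then show ?thesis
    using G b unfolding lift_of_def by (auto intro: a.Sp_scale)
qed

lemma liftable_scale: "liftable k y \<Longrightarrow> b \<in> Zq v \<Longrightarrow> liftable k (b * y)"
  unfolding liftable_def by (meson lift_of_scale)

text \<open>Up to a power of v the lift is Xi (E e + r e_i) times the l-th power of
  \<open>xij\<close>. The lowest terms of the factors are X (e + r u) and a multiple of Xj (l (delta
  + e_j)). The first factor has exponent e_j >= 0 at j, which puts it into the Laurent rings of both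
  \<open>Xij\<close> and \<open>Xj\<close>.\<close>

lemma liftable_prod:
  assumes e: "zvec m e" "e j \<ge> 0" "l = 0 \<or> e j = 0"
  shows "liftable (f e + int l * kap) (X e * Xj (smul (int l) (delta + unitv j)))"
  unfolding liftable_def lift_of_def
\<comment> \<open>The exponent of the first factor of the lift at i is r - e_i.\<close>
proof (intro exI[of _ "nat \<bar>e i\<bar>"] allI impI)
  fix r assume r: "nat \<bar>e i\<bar> \<le> r"
  let ?c = "E e + smul (int r) (unitv i)" and ?X = "Xj (smul (int l) (delta + unitv j))"
  let ?k = "f e + int l * kap + int r * g (unitv i)"
  have cz: "zvec m ?c" using e by simp
  have ci: "?c i \<ge> 0" using r by (simp add: vec_apply)
  have cj: "?c j = e j" using ij by (simp add: vec_apply E_j unitv_def)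
  have Ec: "E ?c = e + smul (int r) u" by (rule E_add_ei)
  have fu: "f u = g (unitv i)" by (simp add: g_def u_def)
  obtain s where s: "xij ^ l - v powi s * ?X \<in> a.Sp X {e. f e > int l * kap}"
    using xij_pow_lead by blast
  \<comment> \<open>Cancels the factor \<open>v powi s\<close> in the lowest term of the power of
    \<open>xij\<close> and accounts for splitting X (e + r u) into X (r u) and X e.\<close>
  define s' where "s' = - s + bilin m L (smul (int r) u) e"
  have hX: "?X \<in> a.Sp X {e. f e = int l * kap}"
    using Xj_hom[of "smul (int l) (delta + unitv j)"]
    by (simp add: fj.lin fj_lead[unfolded fj.add] delta_j vec_apply)
  have lead: "Xi ?c - X (e + smul (int r) u) \<in> a.Sp X {x. f x > f e + int r * g (unitv i)}"
    using a.X1_lead_form[OF f_lin t f_beti cz ci] unfolding Ec by (simp add: f.lin fu)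
  have "Xi ?c * xij ^ l - X (e + smul (int r) u) * (v powi s * ?X)
      \<in> a.Sp X {x. f x > f e + int r * g (unitv i) + int l * kap}"
  proof (rule Sp_lead_mult[OF lead s])
    show "X (e + smul (int r) u) \<in> a.Sp X {x. f x = f e + int r * g (unitv i)}"
      using e by (intro a.Sp_X) (auto simp: f.lin fu)
    show "v powi s * ?X \<in> a.Sp X {e. f e = int l * kap}"
      using hX by (intro a.Sp_scale) auto
  qed
  then have "v powi s' * (Xi ?c * xij ^ l - X (e + smul (int r) u) * (v powi s * ?X)) \<in> a.Sp X {x. f x > ?k}"
    by (intro a.Sp_scale) (auto simp: algebra_simps)
  moreover have "v powi s' * (X (e + smul (int r) u) * (v powi s * ?X)) = X (smul (int r) u) * (X e * ?X)"
  proof -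
    have "X (smul (int r) u) * (X e * ?X) = v powi bilin m L (smul (int r) u) e * (X (e + smul (int r) u) * ?X)"
      using a.qruleD[OF a.q, of "smul (int r) u" e] e by (simp add: mult.assoc[symmetric] add.commute)
    then show ?thesis by (simp add: a.vp_simps s'_def)
  qed
  ultimately have 1: "v powi s' * (Xi ?c * xij ^ l) - X (smul (int r) u) * (X e * ?X) \<in> a.Sp X {x. f x > ?k}"
    by (simp add: right_diff_distrib)
  have "Xi ?c \<in> a.Sp Xi {?c}" using cz by (intro a.Sp_X) auto
  then have 2: "Xi ?c * xij ^ l \<in> a.Sp Xi {c. c i \<ge> 0 \<and> g c = ?k}"
  proof (rule a.Sp_mult[OF a.q1 _ xij_pow(1)])
    fix x y assume "x \<in> {?c}" "y \<in> {c. c i \<ge> 0 \<and> g c = int l * kap}"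
    moreover have "g ?c = f e + int r * g (unitv i)"
      unfolding g_def Ec by (simp add: f.lin u_def)
    ultimately show "x + y \<in> {c. c i \<ge> 0 \<and> g c = ?k}"
      using ci by (auto simp: vec_apply g.add)
  qed
  have "Xi ?c \<in> a.Sp Xij UNIV"
    using c.X_coord[OF cz] cj e by (auto intro: a.Sp_mono)
  then have 3: "Xi ?c * xij ^ l \<in> a.Sp Xij UNIV"
    by (rule a.Sp_mult[OF c.q1 _ xij_pow(2)]) auto
  have "Xi ?c \<in> a.Sp Xj UNIV"
    using Xi_in_Xj[OF cz ci] cj e by auto
  then have 4: "Xi ?c * xij ^ l \<in> a.Sp Xj UNIV"
    by (rule a.Sp_mult[OF b.q1 _ xij_pow(3)]) auto
  show "\<exists>G. G \<in> a.Sp Xi {c. c i \<ge> 0 \<and> g c = ?k} \<and> G \<in> a.Sp Xij UNIV \<and> G \<in> a.Sp Xj UNIV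
     \<and> G - X (smul (int r) u) * (X e * ?X) \<in> a.Sp X {x. f x > ?k}"
    using 1 2 3 4 by (intro exI[of _ "v powi s' * (Xi ?c * xij ^ l)"]) (auto intro: a.Sp_scale)
qed

lemma liftable_X: "y \<in> a.Sp X {c \<in> {c. c j \<ge> 0}. f c = k} \<Longrightarrow> liftable k y"
proof (induction rule: a.Sp.induct)
  case (step b c y)
  have "liftable k (X c)"
    using liftable_prod[of c 0] step by simp
  then show ?case using step by (intro liftable_add liftable_scale)
qed (rule liftable_0)

text \<open>Splitting off c_j copies of delta + e_j leaves an exponent that vanishes at j, where
  \<open>Xj\<close> and X agree.\<close>

lemma liftable_Xj: "y \<in> a.Sp Xj {c \<in> {c. c j \<ge> 0}. fj c = k} \<Longrightarrow> liftable k y"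
proof (induction rule: a.Sp.induct)
  case (step b c y)
  define l where "l = nat (c j)"
  let ?l = "smul (int l) (delta + unitv j)"
  define e where "e = c - ?l"
  have lj: "int l = c j" using step by (simp add: l_def)
  have ej: "e j = 0" by (simp add: e_def vec_apply delta_j lj)
  have ez: "zvec m e" using step by (simp add: e_def)
  have c: "c = e + ?l" by (simp add: e_def)
  have "fj c = fj e + int l * kap"
    by (subst c) (simp add: fj.add fj.smul fj_lead[unfolded fj.add])
  moreover have "fj e = f e" by (simp add: fj_def Evec_fix ej)
  ultimately have k: "k = f e + int l * kap" using step by simp
  have "Xj c = v powi (- bilin m Lj e ?l) * (X e * Xj ?l)"
    using a.qrule_add[OF b.q1 ez, of ?l] b.X1_off[OF ez ej] c by simp
  then have "liftable k (Xj c)"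
    using liftable_prod[OF ez, of l] ej k by (simp add: liftable_scale)
  then show ?case using step by (intro liftable_add liftable_scale)
qed (rule liftable_0)

text \<open>The lift is exact: Xi (r e_i) times the lowest part y0 of y equals the lift G of the
  lowest component of y in X. Hence Xi (r e_i) y' again lies in the Laurent rings of X and mu_j X,
  with a range of degrees shorter by one.\<close>

lemma pair_step:
  "y \<in> a.Sp Xi {c. k \<le> g c \<and> g c < k + int N} \<Longrightarrow> y \<in> a.Sp X UNIV \<Longrightarrow> y \<in> a.Sp Xj UNIV
    \<Longrightarrow> y \<in> a.Sp Xij UNIV"
proof (induction N arbitrary: k y)
  case 0
  have "y \<in> a.Sp Xi {}" using 0(1) by (rule a.Sp_mono) auto
  then show ?case using a.Sp_empty a.Sp.zero by metis
next
  case (Suc N)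
  have Xi_up: "x \<in> a.Sp X {e. f e \<ge> l}" if "x \<in> a.Sp Xi {c. c i \<ge> 0 \<and> g c \<ge> l}" for x l
    using that by (rule a.Sp_map)
      (rule a.Sp_mono[OF a.X1_ge_form[OF f_lin t less_imp_le[OF f_beti]]], auto simp: g_def)
  let ?ei = "\<lambda>r. smul (int r) (unitv i)"
  have Eei: "E (?ei r) = smul (int r) u" for r by (simp add: Evec_smul u_def)
  have gei: "g (?ei r) = int r * g (unitv i)" for r by (simp add: g.lin)
  have fu: "f (smul (int r) u) = int r * g (unitv i)" for r by (simp add: f.lin g_def u_def)
  have lead_ei: "Xi (?ei r) - X (smul (int r) u) \<in> a.Sp X {e. f e > int r * g (unitv i)}" for r
    using a.X1_lead_form[OF f_lin t f_beti, of "?ei r"] by (simp add: Eei fu smul_apply[of _ _ i])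
  have Xi_ei: "Xi (?ei r) \<in> a.Sp Xi {?ei r}" for r by (intro a.Sp_X) auto
  have Xu: "X (smul (int r) u) \<in> a.Sp X {smul (int r) u}" for r by (intro a.Sp_X) auto

  obtain y0 y' where y: "y0 \<in> a.Sp Xi {c \<in> {c. k \<le> g c \<and> g c < k + int (Suc N)}. g c = k}"
    "y' \<in> a.Sp Xi {c \<in> {c. k \<le> g c \<and> g c < k + int (Suc N)}. g c \<noteq> k}" "y = y0 + y'"
    using a.Sp_split[OF Suc.prems(1), of "\<lambda>c. g c = k"] by blast
  obtain N0 :: nat where N0: "y0 \<in> a.Sp Xi {c \<in> {c \<in> {c. k \<le> g c \<and> g c < k + int (Suc N)}. g c = k}. \<bar>c i\<bar> \<le> int N0}"
    using a.Sp_bounded[OF y(1), of "\<lambda>c. c i"] by blast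
  obtain N1 :: nat where N1: "y' \<in> a.Sp Xi {c \<in> {c \<in> {c. k \<le> g c \<and> g c < k + int (Suc N)}. g c \<noteq> k}. \<bar>c i\<bar> \<le> int N1}"
    using a.Sp_bounded[OF y(2), of "\<lambda>c. c i"] by blast

  have zy0: "Xi (?ei r) * y0 \<in> a.Sp Xi {c. c i \<ge> 0 \<and> g c = k + int r * g (unitv i)}" if "r \<ge> N0" for r
    using that by (intro a.Sp_mult[OF a.q1 Xi_ei N0]) (auto simp: vec_apply g.add gei)
  have zy': "Xi (?ei r) * y' \<in> a.Sp Xi {c. c i \<ge> 0 \<and> k + 1 + int r * g (unitv i) \<le> g c
      \<and> g c < k + 1 + int r * g (unitv i) + int N}" if "r \<ge> N1" for r
    using that by (intro a.Sp_mult[OF a.q1 Xi_ei N1]) (auto simp: vec_apply g.add gei)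
  have zy'_up: "Xi (?ei r) * y' \<in> a.Sp X {e. f e > k + int r * g (unitv i)}" if "r \<ge> N1" for r
  proof -
    have "Xi (?ei r) * y' \<in> a.Sp X {e. f e \<ge> k + 1 + int r * g (unitv i)}"
      by (rule Xi_up, rule a.Sp_mono[OF zy'[OF that]]) auto
    then show ?thesis by (rule a.Sp_mono) auto
  qed

  \<comment> \<open>\<open>g\<close> bounds degrees in X only for nonnegative exponents at i;
    multiplication by a power of X'_i achieves this, and \<open>mult_ge\<close> divides it out
    again.\<close>
  have yk: "y \<in> a.Sp X {e. f e \<ge> k}"
  proof (rule a.mult_ge[OF f_lin, where w = "smul (int (max N0 N1)) u" and z = "Xi (?ei (max N0 N1))"])
    let ?r = "max N0 N1"
    show "Xi (?ei ?r) - X (smul (int ?r) u) \<in> a.Sp X {e. f e > f (smul (int ?r) u)}"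
      using lead_ei[of ?r] by (simp add: fu)
    have "Xi (?ei ?r) * y0 \<in> a.Sp X {e. f e \<ge> k + int ?r * g (unitv i)}"
      by (rule Xi_up, rule a.Sp_mono[OF zy0]) auto
    moreover have "Xi (?ei ?r) * y' \<in> a.Sp X {e. f e \<ge> k + int ?r * g (unitv i)}"
      by (rule a.Sp_mono[OF zy'_up]) auto
    ultimately have "Xi (?ei ?r) * y0 + Xi (?ei ?r) * y' \<in> a.Sp X {e. f e \<ge> k + int ?r * g (unitv i)}"
      by (rule a.Sp_add)
    then show "Xi (?ei ?r) * y \<in> a.Sp X {e. f e \<ge> f (smul (int ?r) u) + k}"
      unfolding fu y(3) by (simp add: algebra_simps)
  qed (use Suc.prems in auto)

  \<comment> \<open>Gives the component of degree k in liftable form: both spans are generated by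
    homogeneous elements, so each summand can be cut by degree.\<close>
  obtain y1 y2 where y12: "y1 \<in> a.Sp X {c. c j \<ge> 0}" "y2 \<in> a.Sp Xj {c. c j \<ge> 0}" "y = y1 + y2"
    using b.Sp_Int_decomp[OF Suc.prems(2,3)] by blast
  obtain p1 r1 where 1: "p1 \<in> a.Sp X {c \<in> {c. c j \<ge> 0}. f c = k}" "r1 \<in> a.Sp X {c \<in> {c. c j \<ge> 0}. f c \<noteq> k}"
    "y1 = p1 + r1" using a.Sp_split[OF y12(1), of "\<lambda>c. f c = k"] by blast
  obtain p2 r2 where 2: "p2 \<in> a.Sp Xj {c \<in> {c. c j \<ge> 0}. fj c = k}" "r2 \<in> a.Sp Xj {c \<in> {c. c j \<ge> 0}. fj c \<noteq> k}"
    "y2 = p2 + r2" using a.Sp_split[OF y12(2), of "\<lambda>c. fj c = k"] by blast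
  define p where "p = p1 + p2"
  have pX: "p \<in> a.Sp X {e. f e = k}"
    unfolding p_def
  proof (rule a.Sp_add)
    show "p1 \<in> a.Sp X {e. f e = k}" using 1(1) by (rule a.Sp_mono) auto
    show "p2 \<in> a.Sp X {e. f e = k}" using 2(1) by (rule a.Sp_map) (rule a.Sp_mono[OF Xj_hom], auto)
  qed
  have "r1 + r2 \<in> a.Sp X {e. f e \<noteq> k}"
  proof (rule a.Sp_add)
    show "r1 \<in> a.Sp X {e. f e \<noteq> k}" using 1(2) by (rule a.Sp_mono) auto
    show "r2 \<in> a.Sp X {e. f e \<noteq> k}" using 2(2) by (rule a.Sp_map) (rule a.Sp_mono[OF Xj_hom], auto)
  qed
  moreover have yp: "y - p = r1 + r2" unfolding y12(3) 1(3) 2(3) p_def by simp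
  moreover have "y - p \<in> a.Sp X {e. f e \<ge> k}"
    by (rule a.Sp_diff[OF yk a.Sp_mono[OF pX]]) auto
  ultimately have "y - p \<in> a.Sp X ({e. f e \<ge> k} \<inter> {e. f e \<noteq> k})"
    by (intro a.Sp_Int[OF a.ind]) auto
  then have yp: "y - p \<in> a.Sp X {e. f e > k}" by (rule a.Sp_mono) auto

  have "liftable k p"
    unfolding p_def by (rule liftable_add[OF liftable_X[OF 1(1)] liftable_Xj[OF 2(1)]])
  then obtain P where P: "\<And>r. r \<ge> P \<Longrightarrow> \<exists>G. lift_of k r p G"
    unfolding liftable_def by blast
  \<comment> \<open>One r that admits a lift and makes the exponents at i nonnegative in both parts
    of y.\<close>
  define r where "r = max P (max N0 N1)"
  have r: "r \<ge> P" "r \<ge> N0" "r \<ge> N1" by (auto simp: r_def)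
  let ?K = "k + int r * g (unitv i)" and ?z = "Xi (?ei r)" and ?w = "smul (int r) u"
  obtain G where G: "G \<in> a.Sp Xi {c. c i \<ge> 0 \<and> g c = ?K}" "G \<in> a.Sp Xij UNIV" "G \<in> a.Sp Xj UNIV"
    "G - X ?w * p \<in> a.Sp X {e. f e > ?K}" using P[OF r(1)] unfolding lift_of_def by blast
  have "(?z - X ?w) * y \<in> a.Sp X {e. f e > ?K}"
    by (rule a.Sp_mult[OF a.q lead_ei yk]) (auto simp: f.add)
  from a.Sp_add[OF this a.Sp_mult[OF a.q Xu yp]] have "(?z - X ?w) * y + X ?w * (y - p) \<in> a.Sp X {e. f e > ?K}"
    by (auto simp: f.add fu)
  from a.Sp_diff[OF a.Sp_diff[OF this zy'_up[OF r(3)]] G(4)] have "(?z - X ?w) * y + X ?w * (y - p) - ?z * y' - (G - X ?w * p) \<in> a.Sp X {e. f e > ?K}"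
    .
  then have "?z * y0 - G \<in> a.Sp X {e. f e > ?K}"
    unfolding y(3) by (simp add: algebra_simps)
  \<comment> \<open>All its monomials in \<open>Xi\<close> have degree \<open>?K\<close>, yet in X
    it lies strictly above \<open>?K\<close>.\<close>
  then have "?z * y0 - G = 0"
    by (rule a.lead_inj[OF f_lin t f_beti, of _ ?K, rotated]) 
      (use a.Sp_diff[OF zy0[OF r(2)] G(1)] in \<open>simp add: g_def\<close>)
  then have z: "?z * y' = ?z * y - G"
    unfolding y(3) by (simp add: algebra_simps)
  have eij: "unitv i j = 0" using ij by (auto simp: unitv_def)
  have zX: "?z \<in> a.Sp X UNIV" "?z \<in> a.Sp Xj UNIV"
    using a.X1_coord[of "?ei r"] Xi_in_Xj[of "?ei r"] eij by (auto simp: vec_apply intro: a.Sp_mono)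
  have "?z * y' \<in> a.Sp Xij UNIV"
  proof (rule Suc.IH)
    \<comment> \<open>The window moves up by one because degree k is gone, and by r g(e_i) because
      of the factor \<open>?z\<close>.\<close>
    show "?z * y' \<in> a.Sp Xi {c. k + 1 + int r * g (unitv i) \<le> g c
      \<and> g c < k + 1 + int r * g (unitv i) + int N}"
      using zy'[OF r(3)] by (rule a.Sp_mono) auto
    have "G \<in> a.Sp X UNIV"
      using G(1) by (rule a.Sp_map) (rule a.Sp_mono[OF a.X1_coord], auto)
    then show "?z * y' \<in> a.Sp X UNIV"
      unfolding z using a.Sp_mult[OF a.q zX(1) Suc.prems(2), of UNIV] by (intro a.Sp_diff) auto
    show "?z * y' \<in> a.Sp Xj UNIV"
      unfolding z using a.Sp_mult[OF b.q1 zX(2) Suc.prems(3), of UNIV] G(3) by (intro a.Sp_diff) auto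
  qed
  then have zy: "?z * y \<in> a.Sp Xij UNIV"
    using a.Sp_add[OF _ G(2)] z by fastforce
  \<comment> \<open>X'_i is kept by the mutation at j, so its power is invertible in the Laurent
    ring of \<open>Xij\<close>.\<close>
  have zij: "Xij (?ei r) = ?z"
    using eij by (intro c.X1_off) (auto simp: vec_apply)
  have "Xij (- ?ei r) * (?z * y) \<in> a.Sp Xij UNIV"
    by (rule a.Sp_mult[OF c.q1 a.Sp_X[of "- ?ei r" UNIV] zy]) auto
  moreover have "Xij (- ?ei r) * ?z = v powi bilin m Lij (- ?ei r) (?ei r)"
    using a.qruleD[OF c.q1, of "- ?ei r" "?ei r"] zij by simp
  then have "Xij (- ?ei r) * (?z * y) = v powi bilin m Lij (- ?ei r) (?ei r) * y"
    by (simp add: mult.assoc[symmetric])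
  ultimately have "v powi bilin m Lij (- ?ei r) (?ei r) * y \<in> a.Sp Xij UNIV"
    by simp
  from a.Sp_scale[OF this, of "v powi (- bilin m Lij (- ?ei r) (?ei r))"] show ?case
    by (simp only: a.vp_simps a.Zq_powi simp_thms) simp
qed

lemma pair_inclusion:
  assumes "y \<in> a.Sp X UNIV" "y \<in> a.Sp Xi UNIV" "y \<in> a.Sp Xj UNIV"
  shows "y \<in> a.Sp Xij UNIV"
proof -
  obtain M :: nat where "y \<in> a.Sp Xi {c \<in> UNIV. \<bar>g c\<bar> \<le> int M}"
    using a.Sp_bounded[OF assms(2), of g] by blast
  \<comment> \<open>The interval from -M to M contains 2 M + 1 degrees.\<close>
  then have "y \<in> a.Sp Xi {c. - int M \<le> g c \<and> g c < - int M + int (2 * M + 1)}"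
    by (rule a.Sp_mono) auto
  then show ?thesis using pair_step assms by blast
qed

end

section \<open>Independence over the ring generated by v and its inverse\<close>

context central_unit
begin

text \<open>A normal form for \<open>Zq v\<close>, since \<open>frac_field_of_torus\<close> speaks
  of integer coefficients of the products of powers of v with monomials.\<close>

inductive_set vpoly :: "'f set" where
  zero: "0 \<in> vpoly"
| step: "y \<in> vpoly \<Longrightarrow> of_int b * v powi k + y \<in> vpoly"

lemma vpoly_add: "x \<in> vpoly \<Longrightarrow> y \<in> vpoly \<Longrightarrow> x + y \<in> vpoly"
  by (induction rule: vpoly.induct) (auto simp: add.assoc intro: vpoly.step)

lemma vpoly_scale: "x \<in> vpoly \<Longrightarrow> of_int b * v powi k * x \<in> vpoly"
proof (induction rule: vpoly.induct)
  case (step y c l)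
  have "of_int b * v powi k * (of_int c * v powi l + y)
      = of_int (b * c) * v powi (k + l) + of_int b * v powi k * y"
  proof -
    have "v powi k * of_int c = of_int c * v powi k" by (rule vp_comm)
    then have "of_int b * v powi k * (of_int c * v powi l) = of_int (b * c) * v powi (k + l)"
      by (metis mult.assoc of_int_mult vp_add)
    then show ?thesis by (simp add: distrib_left)
  qed
  then show ?case using vpoly.step[OF step.IH, of "b * c" "k + l"] by simp
qed (simp add: vpoly.zero)

lemma vpoly_mult: "x \<in> vpoly \<Longrightarrow> y \<in> vpoly \<Longrightarrow> x * y \<in> vpoly"
  by (induction rule: vpoly.induct) (auto simp: distrib_right vpoly.zero intro: vpoly_add vpoly_scale)

lemma Zq_vpoly: "x \<in> Zq v \<Longrightarrow> x \<in> vpoly"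
  unfolding Zq_def
proof (induction rule: subring_gen.induct)
  case (gen x)
  then show ?case
    using vpoly.step[OF vpoly.zero, of 1 1] vpoly.step[OF vpoly.zero, of 1 "- 1"] by auto
next
  case one
  then show ?case using vpoly.step[OF vpoly.zero, of 1 0] by simp
next
  case (neg x)
  then show ?case using vpoly_scale[of x "- 1" 0] by simp
qed (auto intro: vpoly.zero vpoly_add vpoly_mult)

lemma vpoly_repr:
  "x \<in> vpoly \<Longrightarrow> \<exists>K b. finite K \<and> (\<forall>k. k \<notin> K \<longrightarrow> b k = 0) \<and> x = (\<Sum>k\<in>K. of_int (b k) * v powi k)"
proof (induction rule: vpoly.induct)
  case zero
  show ?case by (auto intro!: exI[of _ "{}"] exI[of _ "\<lambda>_. 0"])
next
  case (step y c l)
  then obtain K b where K: "finite K" "\<forall>k. k \<notin> K \<longrightarrow> b k = 0" "y = (\<Sum>k\<in>K. of_int (b k) * v powi k)"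
    by blast
  let ?b = "b(l := c + b l)"
  have y: "y = (\<Sum>k\<in>insert l K. of_int (b k) * v powi k)"
    using K by (auto simp: sum.insert_if)
  have "of_int c * v powi l + y = (\<Sum>k\<in>insert l K. of_int (?b k) * v powi k)"
    unfolding y using K(1) by (simp add: sum.insert_remove algebra_simps)
  then show ?case using K by (intro exI[of _ "insert l K"] exI[of _ ?b]) auto
qed

lemma indep_torus:
  assumes X: "\<forall>P a. finite P \<longrightarrow> (\<forall>p\<in>P. zvec m (snd p)) \<longrightarrow>
        (\<Sum>p\<in>P. of_int (a p) * v powi (fst p) * X (snd p)) = 0 \<longrightarrow> (\<forall>p\<in>P. a p = 0)"
  shows "indep X"
  unfolding indep_def
proof (intro allI impI ballI)
  fix C a c
  assume C: "finite C" "\<forall>c\<in>C. zvec m c" "\<forall>c\<in>C. a c \<in> Zq v" "(\<Sum>c\<in>C. a c * X c) = 0" "c \<in> C"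
  have "\<exists>K b. finite K \<and> a c = (\<Sum>k\<in>K. of_int (b k) * v powi k)" if "c \<in> C" for c
    using C(3) that Zq_vpoly[THEN vpoly_repr] by blast
  then obtain K b where K: "\<And>c. c \<in> C \<Longrightarrow> finite (K c)"
      "\<And>c. c \<in> C \<Longrightarrow> a c = (\<Sum>k\<in>K c. of_int (b c k) * v powi k)"
    by metis
  \<comment> \<open>The pairs are swapped because the hypothesis expects the exponent of v as first
    component.\<close>
  let ?P = "prod.swap ` Sigma C K"
  have "(\<Sum>p\<in>?P. of_int (b (snd p) (fst p)) * v powi (fst p) * X (snd p))
      = (\<Sum>(c, k)\<in>Sigma C K. of_int (b c k) * v powi k * X c)"
    by (simp add: sum.reindex case_prod_unfold)
  also have "\<dots> = (\<Sum>c\<in>C. \<Sum>k\<in>K c. of_int (b c k) * v powi k * X c)"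
    using C(1) K(1) by (intro sum.Sigma[symmetric]) auto
  also have "\<dots> = (\<Sum>c\<in>C. a c * X c)"
    using K(2) by (intro sum.cong) (auto simp: sum_distrib_right)
  finally have "(\<Sum>p\<in>?P. of_int (b (snd p) (fst p)) * v powi (fst p) * X (snd p)) = 0"
    using C(4) by simp
  moreover have "finite ?P" "\<forall>p\<in>?P. zvec m (snd p)"
    using C K(1) by auto
  ultimately have "\<forall>p\<in>?P. b (snd p) (fst p) = 0"
    using X[rule_format, of ?P "\<lambda>p. b (snd p) (fst p)"] by blast
  then have "b c k = 0" if "k \<in> K c" for k
    using that C(5) bspec[of ?P "\<lambda>p. b (snd p) (fst p) = 0" "(k, c)"] by auto
  then show "a c = 0"
    using K(2)[OF C(5)] by simp
qed

end

lemma indep_seedI: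
  assumes "n \<le> m" "frac_field_of_torus m v X" "quantum_seed m n d v (X, h, L, B)"
  shows "indep_seed m v n d L B X h"
proof -
  interpret central_unit m v
    using assms(2) by unfold_locales (auto simp: frac_field_of_torus_def)
  have "indep X"
    using assms(2) by (intro indep_torus) (auto simp: frac_field_of_torus_def)
  then show ?thesis
    using assms by unfold_locales (auto simp: quantum_seed_def)
qed

section \<open>Upper bounds under one mutation\<close>

context mutated
begin

lemma Lring_mut: "Lring m v ((clvar (X, h, L, B))(i := mv i)) = Sp X1 UNIV"
  using X1_i X1_unit by (intro Lring_eq_Sp[OF q1 X1_0nz s1.skewL]) (auto simp: clvar_def)

text \<open>For j = i the second mutation undoes the first and leads back to the Laurent ring of X;
  for j distinct from i \<open>pair_inclusion\<close> applies.\<close>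

lemma upper_bound_subset: "upper_bound m n d v (X, h, L, B) \<subseteq> upper_bound m n d v (X1, h, L1, B1)"
proof
  fix y assume y: "y \<in> upper_bound m n d v (X, h, L, B)"
  then have yX: "y \<in> Sp X UNIV" and y_mut: "\<And>j. j \<in> {1..n} \<Longrightarrow> y \<in> Lring m v ((clvar (X, h, L, B))(j := mv j))"
    unfolding upper_bound_def using Lring_seed by auto
  have y1: "y \<in> Sp X1 UNIV" using y_mut[OF i] Lring_mut by simp
  have "y \<in> Lring m v ((clvar (X1, h, L1, B1))(j := s1.mv j))" if j: "j \<in> {1..n}" for j
  proof (cases "j = i")
    case True
    then show ?thesis using mutated.Lring_mut[OF mutated_back] yX by simp
  next
    case False
    obtain Lj Bj Xj where b: "mutated m v n d L B X h j Lj Bj Xj"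
      using mutation_exists[OF j, of 1] is_mutation_mutated[OF j, of 1] by blast
    obtain Lij Bij Xij where c: "mutated m v n d L1 B1 X1 h j Lij Bij Xij"
      using s1.mutation_exists[OF j, of 1] s1.is_mutation_mutated[OF j, of 1] by blast
    define t where "t = (if B i j \<le> 0 then 1 else - 1 :: int)"
    interpret mutation_pair m v n d L B X h i j L1 B1 X1 Lj Bj Xj Lij Bij Xij t
      using mutated_axioms b c False
      by (intro mutation_pair.intro mutation_pair_axioms.intro) (auto simp: t_def)
    have "y \<in> Sp Xj UNIV" using y_mut[OF j] mutated.Lring_mut[OF b] by simp
    then show ?thesis using pair_inclusion[OF yX y1] mutated.Lring_mut[OF c] by simp
  qed
  then show "y \<in> upper_bound m n d v (X1, h, L1, B1)"
    unfolding upper_bound_def s1.Lring_seed using y1 by blast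
qed

lemma upper_bound_eq: "upper_bound m n d v (X, h, L, B) = upper_bound m n d v (X1, h, L1, B1)"
  using upper_bound_subset mutated.upper_bound_subset[OF mutated_back] by blast

end

section \<open>Mutation-equivalent seeds and the upper cluster algebra\<close>

context indep_seed
begin

lemma mut_equiv_upper_bound:
  assumes "mut_equiv m n d v (X, h, L, B) S"
  shows "\<exists>X' L' B'. S = (X', h, L', B') \<and> indep_seed m v n d L' B' X' h
     \<and> upper_bound m n d v S = upper_bound m n d v (X, h, L, B)"
  using assms unfolding mut_equiv_def
proof (induction rule: rtranclp_induct)
  case base
  then show ?case using indep_seed_axioms by blast
next
  case (step S T)
  then obtain X' L' B' where S: "S = (X', h, L', B')" "indep_seed m v n d L' B' X' h"
    "upper_bound m n d v S = upper_bound m n d v (X, h, L, B)" by blast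
  obtain k e where ke: "k \<in> {1..n}" "e \<in> {1, - 1}" "is_mutation m n d v e k S T"
    using step(2) unfolding mut_step_def by blast
  obtain X2 L2 B2 where T: "T = (X2, h, L2, B2)"
    using ke(3) unfolding S(1) is_mutation_def by (cases T) auto
  interpret s: mutated m v n d L' B' X' h k L2 B2 X2
    using indep_seed.is_mutation_mutated[OF S(2) ke(1,2)] ke(3) unfolding S(1) T by blast
  show ?case
    using s.upper_bound_eq S(3) s.seed1 unfolding S(1) T by blast
qed

text \<open>The common upper bound lies in the Laurent ring of each equivalent seed. Conversely, the
  Laurent rings defining the upper bound are those of the seed and of its one-step
  mutations.\<close>

lemma upper_bound_eq_upper_cluster_algebra:
  "upper_bound m n d v (X, h, L, B) = upper_cluster_algebra m n d v (X, h, L, B)"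
proof
  show "upper_bound m n d v (X, h, L, B) \<subseteq> upper_cluster_algebra m n d v (X, h, L, B)"
    using mut_equiv_upper_bound unfolding upper_cluster_algebra_def upper_bound_def by blast
  show "upper_cluster_algebra m n d v (X, h, L, B) \<subseteq> upper_bound m n d v (X, h, L, B)"
  proof
    fix y assume y: "y \<in> upper_cluster_algebra m n d v (X, h, L, B)"
    have "mut_equiv m n d v (X, h, L, B) (X, h, L, B)"
      by (simp add: mut_equiv_def)
    then have "y \<in> Lring m v (clvar (X, h, L, B))"
      using y unfolding upper_cluster_algebra_def by blast
    moreover have "y \<in> Lring m v ((clvar (X, h, L, B))(j := mv j))" if j: "j \<in> {1..n}" for j
    proof -
      obtain Xj Lj Bj where mut: "is_mutation m n d v 1 j (X, h, L, B) (Xj, h, Lj, Bj)"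
        using mutation_exists[OF j, of 1] by blast
      then have "mut_equiv m n d v (X, h, L, B) (Xj, h, Lj, Bj)"
        unfolding mut_equiv_def mut_step_def using j by blast
      then have yj: "y \<in> Lring m v (clvar (Xj, h, Lj, Bj))"
        using y unfolding upper_cluster_algebra_def by blast
      have "mutated m v n d L B X h j Lj Bj Xj"
        using is_mutation_mutated[OF j _ mut] by simp
      then interpret s: mutated m v n d L B X h j Lj Bj Xj .
      show ?thesis
        using yj s.s1.Lring_seed s.Lring_mut by simp
    qed
    ultimately show "y \<in> upper_bound m n d v (X, h, L, B)"
      unfolding upper_bound_def by blast
  qed
qed

end

theorem theorem4p8:
  fixes m n :: nat and d :: "nat \<Rightarrow> nat" and v :: "'f::division_ring"
    and X X' :: "(nat \<Rightarrow> int) \<Rightarrow> 'f" and h :: "nat \<Rightarrow> nat \<Rightarrow> 'f"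
    and L0 L1 B0 B1 :: "nat \<Rightarrow> nat \<Rightarrow> int" and i :: nat and eps :: int
  assumes "1 \<le> n" and "n \<le> m"
    and "frac_field_of_torus m v X"
    and "quantum_seed m n d v (X, h, L0, B0)"
    and "coprime_seed m n d v (X, h, L0, B0)"
    and "i \<in> {1..n}" and "eps \<in> {1, -1}"
    and "is_mutation m n d v eps i (X, h, L0, B0) (X', h, L1, B1)"
  shows "upper_bound m n d v (X, h, L0, B0) = upper_bound m n d v (X', h, L1, B1) \<and>
         ((\<forall>S. mut_equiv m n d v (X, h, L0, B0) S \<longrightarrow> coprime_seed m n d v S) \<longrightarrow>
          (\<forall>S. mut_equiv m n d v (X, h, L0, B0) S \<longrightarrow>
               upper_bound m n d v S = upper_cluster_algebra m n d v (X, h, L0, B0)))"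
proof -
  interpret s: indep_seed m v n d L0 B0 X h
    by (rule indep_seedI) fact+
  interpret s: mutated m v n d L0 B0 X h i L1 B1 X'
    by (rule s.is_mutation_mutated) fact+
  show ?thesis
    using s.upper_bound_eq s.mut_equiv_upper_bound s.upper_bound_eq_upper_cluster_algebra by metis
qed

end
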